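(* Consider the system $y_{t+1}=\theta f(y_t)+u_t+w_{t+1}$, $t\ge 0$, under the standing assumptions in the context. For $L>0$ put $S_4^L=\{x\in\mathbb{R}: |f(x)|<L|x|^4\}$, and let $\ell$ denote Lebesgue measure on $\mathbb{R}$. If there exist two numbers $\delta,L>0$ such that, as $l\to+\infty$, $$\sup_{x\in\mathbb{R}}\frac{\ell(S_4^L\cap[x-l,x+l])}{l}=O\left(\frac{1}{(\log(\log l))^{1+\delta}}\right),$$ then the system is unstabilizable.
   Context: System: $y_{t+1}=\theta f(y_t)+u_t+w_{t+1}$, $t\ge0$, where $\theta\in\mathbb{R}$ is an unknown (random) parameter and $y_t,u_t,w_t\in\mathbb{R}$ are the output, input and noise. Standing assumptions: $f:\mathbb{R}\to\mathbb{R}$ is a known piecewise continuous function; the initial value $y_0$ is independent of $\theta$ and $\{w_t\}$; (A1) $\{w_t\}$ is an i.i.d. random sequence with $w_1\sim N(0,1)$; (A2) $\theta\sim N(\theta_0,P_0)$, with $P_0>0$, is independent of $\{w_t\}$. A feedback control law is a sequence $\{u_t\}_{t\ge0}$ such that $u_t$ is measurable with respect to $\mathcal{F}_t^y=\sigma\{y_i:0\le i\le t\}$ for every $t\ge0$. Definition: the system is unstabilizable if for any feedback control law $\{u_t\}$ there exists an initial $y_0$ such that, for some event $D$ with $P(D)>0$, $\limsup_{t\to+\infty}\frac1t\sum_{i=1}^t y_i^2=+\infty$ on $D$. *)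

theory Defs
  imports "HOL-Probability.Probability" "HOL-Library.Landau_Symbols"
begin

text \<open>Pieces may accumulate only at infinity, and jumps are finite.\<close>

definition piecewise_continuous :: "(real \<Rightarrow> real) \<Rightarrow> bool" where
  "piecewise_continuous f \<longleftrightarrow>
     (\<forall>a b. finite {x \<in> {a..b}. \<not> isCont f x}) \<and>
     (\<forall>x. (\<exists>l. (f \<longlongrightarrow> l) (at_left x)) \<and> (\<exists>r. (f \<longlongrightarrow> r) (at_right x)))"

text \<open>
  The control law is chosen before the initial value, and the outputs depend on both. A law is
  therefore represented by Borel functions \<open>h t\<close> of the output history, with
  \<open>u\<^sub>t = h t (y\<^sub>0, \<dots>, y\<^sub>t)\<close>. The two lemmas below show that the inputs
  of this form are exactly those measurable with respect to the sigma-algebra generated by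
  \<open>y\<^sub>0, \<dots>, y\<^sub>t\<close>.
\<close>

definition history :: "(nat \<Rightarrow> 'a \<Rightarrow> real) \<Rightarrow> nat \<Rightarrow> 'a \<Rightarrow> nat \<Rightarrow> real" where
  "history y t \<omega> = (\<lambda>i\<in>{..t}. y i \<omega>)"

definition feedback_law :: "(nat \<Rightarrow> (nat \<Rightarrow> real) \<Rightarrow> real) \<Rightarrow> bool" where
  "feedback_law h \<longleftrightarrow> (\<forall>t. h t \<in> borel_measurable (\<Pi>\<^sub>M i\<in>{..t}. borel))"

definition output_algebra :: "'a set \<Rightarrow> (nat \<Rightarrow> 'a \<Rightarrow> real) \<Rightarrow> nat \<Rightarrow> 'a measure" where
  "output_algebra \<Omega> y t = sigma \<Omega> {y i -` B \<inter> \<Omega> | i B. i \<le> t \<and> B \<in> sets borel}"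

lemma space_output_algebra: "space (output_algebra \<Omega> y t) = \<Omega>"
  unfolding output_algebra_def by (rule space_measure_of) blast

lemma sets_output_algebra:
  "sets (output_algebra \<Omega> y t) =
     sigma_sets \<Omega> {y i -` B \<inter> \<Omega> | i B. i \<le> t \<and> B \<in> sets borel}"
  unfolding output_algebra_def by (rule sets_measure_of) blast

lemma measurable_history_output_algebra:
  "history y t \<in> output_algebra \<Omega> y t \<rightarrow>\<^sub>M (\<Pi>\<^sub>M i\<in>{..t}. borel)"
  unfolding history_def
proof (rule measurable_restrict)
  fix i assume "i \<in> {..t}"
  then show "y i \<in> borel_measurable (output_algebra \<Omega> y t)"
    by (intro measurableI) (auto simp: space_output_algebra sets_output_algebra)
qed

lemma sets_output_algebra_eq:
  "sets (output_algebra \<Omega> y t) =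
     {history y t -` B \<inter> \<Omega> | B. B \<in> sets (\<Pi>\<^sub>M i\<in>{..t}. (borel :: real measure))}"
proof -
  let ?P = "\<Pi>\<^sub>M i\<in>{..t}. (borel :: real measure)"
  have sp: "space (output_algebra \<Omega> y t) = \<Omega>"
    by (rule space_output_algebra)
  have sub: "sets (output_algebra \<Omega> y t) \<subseteq> sets (vimage_algebra \<Omega> (history y t) ?P)"
  proof -
    have "y i -` B \<inter> \<Omega> \<in> sets (vimage_algebra \<Omega> (history y t) ?P)"
      if "i \<le> t" "B \<in> sets borel" for i B
    proof -
      have "(\<lambda>x. x i) -` B \<inter> space ?P \<in> sets ?P"
        using that by (intro measurable_sets[OF measurable_component_singleton]) auto
      moreover have "y i -` B \<inter> \<Omega> = history y t -` ((\<lambda>x. x i) -` B \<inter> space ?P) \<inter> \<Omega>"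
        using that by (auto simp: history_def space_PiM)
      ultimately show ?thesis by (simp only: in_vimage_algebra)
    qed
    then have "sigma_sets \<Omega> {y i -` B \<inter> \<Omega> | i B. i \<le> t \<and> B \<in> sets borel}
        \<subseteq> sets (vimage_algebra \<Omega> (history y t) ?P)"
      using sets.sigma_sets_subset[of "{y i -` B \<inter> \<Omega> | i B. i \<le> t \<and> B \<in> sets borel}"
          "vimage_algebra \<Omega> (history y t) ?P"] by auto
    then show ?thesis
      unfolding sets_output_algebra .
  qed
  have "history y t \<in> \<Omega> \<rightarrow> space ?P" by (auto simp: history_def space_PiM)
  then have "sets (vimage_algebra \<Omega> (history y t) ?P) = {history y t -` B \<inter> \<Omega> | B. B \<in> sets ?P}"
    by (rule sets_vimage_algebra2)
  with sub measurable_sets[OF measurable_history_output_algebra[of y t \<Omega>]] sp show ?thesis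
    by auto
qed

lemma feedback_law_measurable:
  assumes "feedback_law h"
  shows "(\<lambda>\<omega>. h t (history y t \<omega>)) \<in> borel_measurable (output_algebra \<Omega> y t)"
  using assms unfolding feedback_law_def
  by (intro measurable_compose[OF measurable_history_output_algebra]) auto

lemma feedback_law_exists:
  fixes u :: "nat \<Rightarrow> 'a \<Rightarrow> real"
  assumes u: "\<And>t. u t \<in> borel_measurable (output_algebra \<Omega> y t)"
  obtains h where "feedback_law h" and "\<And>t \<omega>. \<omega> \<in> \<Omega> \<Longrightarrow> u t \<omega> = h t (history y t \<omega>)"
proof -
  have "\<exists>g \<in> borel_measurable (\<Pi>\<^sub>M i\<in>{..t}. borel). \<forall>\<omega>\<in>\<Omega>. u t \<omega> = g (history y t \<omega>)" for t
  proof -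
    let ?F = "output_algebra \<Omega> y t" and ?P = "\<Pi>\<^sub>M i\<in>{..t}. (borel :: real measure)"
    have sp: "space ?F = \<Omega>"
      by (rule space_output_algebra)
    obtain s where s: "\<And>k. simple_function ?F (s k)"
      and lim: "\<And>\<omega>. \<omega> \<in> \<Omega> \<Longrightarrow> (\<lambda>k. s k \<omega>) \<longlonglongrightarrow> u t \<omega>"
      using borel_measurable_implies_sequence_metric[OF u[of t], of 0] sp by metis
    have "\<exists>g \<in> borel_measurable ?P. \<forall>\<omega>\<in>\<Omega>. s k \<omega> = g (history y t \<omega>)" for k
    proof -
      have "\<exists>B. B \<in> sets ?P \<and> s k -` {v} \<inter> \<Omega> = history y t -` B \<inter> \<Omega>" for v
        using simple_functionD(2)[OF s[of k], of "{v}"] sp by (auto simp: sets_output_algebra_eq)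
      then obtain B where B: "\<And>v. B v \<in> sets ?P"
        and BE: "\<And>v. s k -` {v} \<inter> \<Omega> = history y t -` B v \<inter> \<Omega>" by metis
      have fin: "finite (s k ` \<Omega>)" using simple_functionD(1)[OF s[of k]] sp by simp
      let ?g = "\<lambda>z. \<Sum>v\<in>s k ` \<Omega>. v * indicator (B v) z"
      have "?g \<in> borel_measurable ?P" using B by (intro borel_measurable_sum) auto
      moreover have "s k \<omega> = ?g (history y t \<omega>)" if "\<omega> \<in> \<Omega>" for \<omega>
      proof -
        have "history y t \<omega> \<in> B v \<longleftrightarrow> s k \<omega> = v" for v using BE[of v] that by auto
        then have "?g (history y t \<omega>) = (\<Sum>v\<in>s k ` \<Omega>. if s k \<omega> = v then v else 0)"
          by (intro sum.cong) (auto simp: indicator_def)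
        also have "\<dots> = s k \<omega>" using fin that by simp
        finally show ?thesis by simp
      qed
      ultimately show ?thesis by (intro bexI[of _ ?g] ballI)
    qed
    then obtain g where g: "\<And>k. g k \<in> borel_measurable ?P"
      and gE: "\<And>k \<omega>. \<omega> \<in> \<Omega> \<Longrightarrow> s k \<omega> = g k (history y t \<omega>)" by metis
    have "(\<lambda>z. lim (\<lambda>k. g k z)) \<in> borel_measurable ?P" using g by (rule borel_measurable_lim_metric)
    moreover have "u t \<omega> = lim (\<lambda>k. g k (history y t \<omega>))" if "\<omega> \<in> \<Omega>" for \<omega>
      using limI[OF lim[OF that]] gE[OF that] by simp
    ultimately show ?thesis by (intro bexI[of _ "\<lambda>z. lim (\<lambda>k. g k z)"] ballI)
  qed
  then obtain h where "\<And>t. h t \<in> borel_measurable (\<Pi>\<^sub>M i\<in>{..t}. borel)"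
    and "\<And>t \<omega>. \<omega> \<in> \<Omega> \<Longrightarrow> u t \<omega> = h t (history y t \<omega>)" by metis
  then show thesis by (intro that) (auto simp: feedback_law_def)
qed

text \<open>
  The library's \<open>indep_var\<close> needs both variables to take values in the same type.
\<close>

definition indep_rv ::
  "'a measure \<Rightarrow> 'b measure \<Rightarrow> ('a \<Rightarrow> 'b) \<Rightarrow> 'c measure \<Rightarrow> ('a \<Rightarrow> 'c) \<Rightarrow> bool" where
  "indep_rv M S X T Y \<longleftrightarrow>
     X \<in> M \<rightarrow>\<^sub>M S \<and> Y \<in> M \<rightarrow>\<^sub>M T \<and>
     prob_space.indep_set M (sets (vimage_algebra (space M) X S)) (sets (vimage_algebra (space M) Y T))"

definition closed_loop ::
  "(real \<Rightarrow> real) \<Rightarrow> ('a \<Rightarrow> real) \<Rightarrow> (nat \<Rightarrow> 'a \<Rightarrow> real) \<Rightarrow> (nat \<Rightarrow> (nat \<Rightarrow> real) \<Rightarrow> real) \<Rightarrow>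
   (nat \<Rightarrow> 'a \<Rightarrow> real) \<Rightarrow> bool" where
  "closed_loop f \<theta> w h y \<longleftrightarrow>
     (\<forall>t \<omega>. y (Suc t) \<omega> = \<theta> \<omega> * f (y t \<omega>) + h t (history y t \<omega>) + w (Suc t) \<omega>)"

text \<open>
  The initial value is a random variable jointly independent of \<open>\<theta>\<close> and the noise
  \<open>w\<^sub>1, w\<^sub>2, \<dots>\<close> (\<open>w 0\<close> is unused); constants are allowed. Given the law,
  \<open>y\<close> is determined by \<open>y 0\<close>, so quantifying over \<open>y\<close> amounts to
  quantifying over the initial value.
\<close>

definition unstabilizable ::
  "'a measure \<Rightarrow> (real \<Rightarrow> real) \<Rightarrow> ('a \<Rightarrow> real) \<Rightarrow> (nat \<Rightarrow> 'a \<Rightarrow> real) \<Rightarrow> bool" where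
  "unstabilizable M f \<theta> w \<longleftrightarrow>
     (\<forall>h. feedback_law h \<longrightarrow>
       (\<exists>y. closed_loop f \<theta> w h y \<and>
            indep_rv M borel (y 0)
              (borel \<Otimes>\<^sub>M (\<Pi>\<^sub>M t\<in>{1..}. borel)) (\<lambda>\<omega>. (\<theta> \<omega>, \<lambda>t\<in>{1..}. w t \<omega>)) \<and>
            (\<exists>D \<in> sets M. measure M D > 0 \<and>
              (\<forall>\<omega>\<in>D. limsup (\<lambda>t. ereal (1 / real t * (\<Sum>i = 1..t. (y i \<omega>)\<^sup>2))) = \<infinity>))))"

definition S4 :: "(real \<Rightarrow> real) \<Rightarrow> real \<Rightarrow> real set" where
  "S4 f L = {x. \<bar>f x\<bar> < L * \<bar>x\<bar> ^ 4}"

end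

theory Submission
  imports Defs "HOL-Real_Asymp.Real_Asymp"
begin

text \<open>
  Given the outputs up to time \<open>t\<close>, the parameter is normal with precision
  \<open>r\<^sub>t = 1 / P\<^sub>0 + (\<Sum>i<t. f (y\<^sub>i)\<^sup>2)\<close>, whatever the control law, and hence \<open>y\<^sub>t\<^sub>+\<^sub>1\<close> is normal
  with variance \<open>\<sigma>\<^sub>t\<^sup>2 = r\<^sub>t\<^sub>+\<^sub>1 / r\<^sub>t\<close>; the law can only move its mean. As long as every output
  avoids \<open>S4\<close> and satisfies \<open>\<bar>y\<^sub>t\<^sub>+\<^sub>1\<bar> \<ge> \<sigma>\<^sub>t / (t + N)\<^sup>2\<close>, the logarithm of \<open>r\<^sub>t\<close> grows so fast that
  \<open>\<sigma>\<^sub>t \<ge> exp (2\<^sup>t\<^sup>+\<^sup>N)\<close>, provided that \<open>y\<^sub>0\<close> is a large constant outside \<open>S4\<close>. Then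
  \<open>log (log \<sigma>\<^sub>t)\<close> is at least of order \<open>t + N\<close>, so the density hypothesis makes the probability of a
  first failure at time \<open>t\<close> at most of order \<open>(t + N) powr - (1 + \<delta>) + (t + N) powr - 2\<close>. For large
  \<open>N\<close> these probabilities sum to less than one.
\<close>

section \<open>Gaussian filtering\<close>

lemma measurable_normal_density [measurable]:
  assumes [measurable]: "\<mu> \<in> borel_measurable N" "\<sigma> \<in> borel_measurable N" "g \<in> borel_measurable N"
  shows "(\<lambda>x. normal_density (\<mu> x) (\<sigma> x) (g x)) \<in> borel_measurable N"
  unfolding normal_density_def by measurable

lemma nn_integral_normal_density:
  assumes "0 < \<sigma>"
  shows "(\<integral>\<^sup>+x. ennreal (normal_density \<mu> \<sigma> x) \<partial>lborel) = 1"
  using assms by (subst nn_integral_eq_integral) (auto intro: integral_normal_density)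

text \<open>Completing the square in \<open>x\<close>: likelihood times prior becomes predictive
  density times posterior density for one observation \<open>y = x * a + u + noise\<close>. The
  normalising constants agree because the product of the two variances is \<open>1 / r\<close> on
  both sides.\<close>

lemma normal_density_bayes:
  fixes r a u m x y :: real
  assumes r: "0 < r"
  shows "normal_density 0 1 (y - x * a - u) * normal_density m (1 / sqrt r) x =
    normal_density (m * a + u) (sqrt ((r + a\<^sup>2) / r)) y *
    normal_density ((r * m + a * (y - u)) / (r + a\<^sup>2)) (1 / sqrt (r + a\<^sup>2)) x"
proof -
  define q where "q = r + a\<^sup>2"
  have q: "0 < q" using r by (simp add: q_def add_pos_nonneg)
  define v where "v = y - u"
  have sq: "(sqrt (q / r))\<^sup>2 = q / r" "(1 / sqrt r)\<^sup>2 = 1 / r" "(1 / sqrt q)\<^sup>2 = 1 / q"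
    using r q by (simp_all add: power_divide)
  have "q * ((v - x * a)\<^sup>2 + r * (x - m)\<^sup>2) = r * (v - m * a)\<^sup>2 + (q * x - (r * m + a * v))\<^sup>2"
    unfolding q_def by (simp add: power2_eq_square algebra_simps)
  then have "(v - x * a)\<^sup>2 + r * (x - m)\<^sup>2 = (r * (v - m * a)\<^sup>2 + (q * x - (r * m + a * v))\<^sup>2) / q"
    using q by (simp add: field_simps)
  also have "\<dots> = r / q * (v - m * a)\<^sup>2 + q * (x - (r * m + a * v) / q)\<^sup>2"
    using q by (simp add: field_simps power2_eq_square)
  finally have e: "(v - x * a)\<^sup>2 + r * (x - m)\<^sup>2 =
    r / q * (v - m * a)\<^sup>2 + q * (x - (r * m + a * v) / q)\<^sup>2" .
  have ex: "exp (- (v - x * a)\<^sup>2 / 2) * exp (- (x - m)\<^sup>2 / (2 * (1 / r))) =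
    exp (- (v - m * a)\<^sup>2 / (2 * (q / r))) * exp (- (x - (r * m + a * v) / q)\<^sup>2 / (2 * (1 / q)))"
    unfolding exp_add[symmetric] using e r q by (simp add: field_simps)
  have pre: "1 / sqrt (2 * pi) * (1 / sqrt (2 * pi * (1 / r))) =
    1 / sqrt (2 * pi * (q / r)) * (1 / sqrt (2 * pi * (1 / q)))"
    using r q by (simp add: real_sqrt_mult real_sqrt_divide field_simps)
  have "normal_density 0 1 (y - x * a - u) * normal_density m (1 / sqrt r) x =
    (1 / sqrt (2 * pi) * (1 / sqrt (2 * pi * (1 / r)))) *
    (exp (- (v - x * a)\<^sup>2 / 2) * exp (- (x - m)\<^sup>2 / (2 * (1 / r))))"
    unfolding normal_density_def sq v_def by (simp add: algebra_simps)
  also have "\<dots> = (1 / sqrt (2 * pi * (q / r)) * (1 / sqrt (2 * pi * (1 / q)))) *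
    (exp (- (v - m * a)\<^sup>2 / (2 * (q / r))) * exp (- (x - (r * m + a * v) / q)\<^sup>2 / (2 * (1 / q))))"
    unfolding ex pre ..
  also have "\<dots> = normal_density (m * a + u) (sqrt (q / r)) y *
    normal_density ((r * m + a * (y - u)) / q) (1 / sqrt q) x"
    unfolding normal_density_def sq v_def by (simp add: algebra_simps)
  finally show ?thesis unfolding q_def .
qed

text \<open>The conditional law of \<open>\<theta>\<close> given \<open>X\<close> is normal with mean \<open>m X\<close> and precision
  \<open>r X\<close>, expressed without conditional probabilities.\<close>

definition gaussian_posterior ::
  "'a measure \<Rightarrow> 'b measure \<Rightarrow> ('a \<Rightarrow> 'b) \<Rightarrow> ('a \<Rightarrow> real) \<Rightarrow> ('b \<Rightarrow> real) \<Rightarrow> ('b \<Rightarrow> real) \<Rightarrow> bool" where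
  "gaussian_posterior M N X \<theta> m r \<longleftrightarrow>
     (\<forall>F \<in> borel_measurable (N \<Otimes>\<^sub>M borel).
        (\<integral>\<^sup>+\<omega>. F (X \<omega>, \<theta> \<omega>) \<partial>M) =
        (\<integral>\<^sup>+\<omega>. (\<integral>\<^sup>+x. F (X \<omega>, x) * ennreal (normal_density (m (X \<omega>)) (1 / sqrt (r (X \<omega>))) x) \<partial>lborel) \<partial>M))"

text \<open>One step of the Kalman filter, with \<open>X\<close> the observed past and
  \<open>Y\<close> the next output. Since conditioning is expressed through integrals, it follows
  from Fubini and \<open>normal_density_bayes\<close>. The input \<open>u\<close> enters only the
  means \<open>\<mu>\<close> and \<open>m'\<close>; \<open>s\<close> and \<open>r'\<close> do not
  see it.\<close>

lemma gaussian_posterior_step: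
  fixes X :: "'a \<Rightarrow> 'b" and \<theta> W :: "'a \<Rightarrow> real" and r a u m :: "'b \<Rightarrow> real"
  assumes X[measurable]: "X \<in> M \<rightarrow>\<^sub>M N"
    and \<theta>[measurable]: "\<theta> \<in> borel_measurable M"
    and W[measurable]: "W \<in> borel_measurable M"
    and [measurable]: "a \<in> borel_measurable N" "u \<in> borel_measurable N"
      "r \<in> borel_measurable N" "m \<in> borel_measurable N"
    and r: "\<And>x. 0 < r x"
    and post: "gaussian_posterior M N X \<theta> m r"
    and noise: "\<And>F. F \<in> borel_measurable ((N \<Otimes>\<^sub>M borel) \<Otimes>\<^sub>M borel) \<Longrightarrow>
      (\<integral>\<^sup>+\<omega>. F ((X \<omega>, \<theta> \<omega>), W \<omega>) \<partial>M) =
      (\<integral>\<^sup>+\<omega>. (\<integral>\<^sup>+z. F ((X \<omega>, \<theta> \<omega>), z) * ennreal (normal_density 0 1 z) \<partial>lborel) \<partial>M)"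
  defines "Y \<equiv> \<lambda>\<omega>. \<theta> \<omega> * a (X \<omega>) + u (X \<omega>) + W \<omega>"
    and "\<mu> \<equiv> \<lambda>x. m x * a x + u x"
    and "s \<equiv> \<lambda>x. sqrt ((r x + (a x)\<^sup>2) / r x)"
    and "m' \<equiv> \<lambda>(x, y). (r x * m x + a x * (y - u x)) / (r x + (a x)\<^sup>2)"
    and "r' \<equiv> \<lambda>(x, y). r x + (a x)\<^sup>2"
  shows gaussian_predictive: "F \<in> borel_measurable (N \<Otimes>\<^sub>M borel) \<Longrightarrow>
      (\<integral>\<^sup>+\<omega>. F (X \<omega>, Y \<omega>) \<partial>M) =
      (\<integral>\<^sup>+\<omega>. (\<integral>\<^sup>+y. F (X \<omega>, y) * ennreal (normal_density (\<mu> (X \<omega>)) (s (X \<omega>)) y) \<partial>lborel) \<partial>M)"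
    and gaussian_posterior_update:
      "gaussian_posterior M (N \<Otimes>\<^sub>M borel) (\<lambda>\<omega>. (X \<omega>, Y \<omega>)) \<theta> m' r'"
proof -
  have r': "0 < r x + (a x)\<^sup>2" for x using r[of x] by (simp add: add_pos_nonneg)
  have [measurable]: "Y \<in> borel_measurable M" unfolding Y_def by measurable
  have [measurable]: "m' \<in> borel_measurable (N \<Otimes>\<^sub>M borel)" "r' \<in> borel_measurable (N \<Otimes>\<^sub>M borel)"
    unfolding m'_def r'_def by measurable
  have [measurable]: "\<mu> \<in> borel_measurable N" "s \<in> borel_measurable N"
    unfolding \<mu>_def s_def by measurable
  let ?n = "\<lambda>\<mu> \<sigma> x. ennreal (normal_density \<mu> \<sigma> x)"
  let ?p = "\<lambda>z t. ?n (m' z) (1 / sqrt (r' z)) t"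
  \<comment> \<open>Joint law of past, output and parameter, disintegrated in that order. Taking
    \<open>F\<close> constant in the parameter gives the predictive law; the predictive law applied
    to the inner integral then gives the posterior.\<close>
  have key: "(\<integral>\<^sup>+\<omega>. F ((X \<omega>, Y \<omega>), \<theta> \<omega>) \<partial>M) =
    (\<integral>\<^sup>+\<omega>. (\<integral>\<^sup>+y. (\<integral>\<^sup>+t. F ((X \<omega>, y), t) * ?p (X \<omega>, y) t \<partial>lborel) * ?n (\<mu> (X \<omega>)) (s (X \<omega>)) y \<partial>lborel) \<partial>M)"
    if [measurable]: "F \<in> borel_measurable ((N \<Otimes>\<^sub>M borel) \<Otimes>\<^sub>M borel)" for F :: "('b \<times> real) \<times> real \<Rightarrow> ennreal"
  proof -
    let ?F' = "\<lambda>q. F ((fst (fst q), snd (fst q) * a (fst (fst q)) + u (fst (fst q)) + snd q), snd (fst q))"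
    let ?G = "\<lambda>p. \<integral>\<^sup>+z. F ((fst p, snd p * a (fst p) + u (fst p) + z), snd p) * ?n 0 1 z \<partial>lborel"
    have "(\<integral>\<^sup>+\<omega>. F ((X \<omega>, Y \<omega>), \<theta> \<omega>) \<partial>M) =
      (\<integral>\<^sup>+\<omega>. ?F' ((X \<omega>, \<theta> \<omega>), W \<omega>) \<partial>M)"
      by (simp add: Y_def)
    also have "\<dots> = (\<integral>\<^sup>+\<omega>. (\<integral>\<^sup>+z. ?F' ((X \<omega>, \<theta> \<omega>), z) * ?n 0 1 z \<partial>lborel) \<partial>M)"
      by (rule noise) measurable
    also have "\<dots> = (\<integral>\<^sup>+\<omega>. ?G (X \<omega>, \<theta> \<omega>) \<partial>M)"
      by simp
    also have "\<dots> = (\<integral>\<^sup>+\<omega>. (\<integral>\<^sup>+t. ?G (X \<omega>, t) *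
        ?n (m (X \<omega>)) (1 / sqrt (r (X \<omega>))) t \<partial>lborel) \<partial>M)"
      by (rule post[unfolded gaussian_posterior_def, rule_format]) measurable
    also have "\<dots> = (\<integral>\<^sup>+\<omega>. (\<integral>\<^sup>+y. (\<integral>\<^sup>+t. F ((X \<omega>, y), t) * ?p (X \<omega>, y) t \<partial>lborel) * ?n (\<mu> (X \<omega>)) (s (X \<omega>)) y \<partial>lborel) \<partial>M)"
    proof (rule nn_integral_cong)
      fix \<omega> assume "\<omega> \<in> space M"
      then have x: "X \<omega> \<in> space N" using X by (meson measurable_space)
      \<comment> \<open>With the past frozen at \<open>x\<close>, substituting
        \<open>y = t * a x + u x + z\<close> turns the noise density into the likelihood of
        \<open>y\<close>; the Bayes identity and Fubini then move the integral over the parameter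
        \<open>t\<close> inside.\<close>
      define x where "x = X \<omega>"
      note [measurable] = x[folded x_def]
      have "(\<integral>\<^sup>+t. (\<integral>\<^sup>+z. F ((x, t * a x + u x + z), t) * ?n 0 1 z \<partial>lborel) * ?n (m x) (1 / sqrt (r x)) t \<partial>lborel) =
        (\<integral>\<^sup>+t. (\<integral>\<^sup>+y. F ((x, y), t) * ?n 0 1 (y - t * a x - u x) \<partial>lborel) * ?n (m x) (1 / sqrt (r x)) t \<partial>lborel)"
      proof (intro nn_integral_cong)
        fix t :: real
        have "(\<integral>\<^sup>+y. F ((x, y), t) * ?n 0 1 (y - t * a x - u x) \<partial>lborel) =
          (\<integral>\<^sup>+z. F ((x, t * a x + u x + z), t) * ?n 0 1 z \<partial>lborel)"
          by (subst nn_integral_real_affine[where c = 1 and t = "t * a x + u x"]) (simp_all add: algebra_simps)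
        then show "(\<integral>\<^sup>+z. F ((x, t * a x + u x + z), t) * ?n 0 1 z \<partial>lborel) * ?n (m x) (1 / sqrt (r x)) t =
          (\<integral>\<^sup>+y. F ((x, y), t) * ?n 0 1 (y - t * a x - u x) \<partial>lborel) * ?n (m x) (1 / sqrt (r x)) t"
          by simp
      qed
      also have "\<dots> = (\<integral>\<^sup>+t. (\<integral>\<^sup>+y. F ((x, y), t) * ?p (x, y) t * ?n (\<mu> x) (s x) y \<partial>lborel) \<partial>lborel)"
      proof (intro nn_integral_cong)
        fix t :: real
        have "?n 0 1 (y - t * a x - u x) * ?n (m x) (1 / sqrt (r x)) t = ?p (x, y) t * ?n (\<mu> x) (s x) y" for y
          using normal_density_bayes[OF r[of x], of y t "a x" "u x" "m x"]
          by (simp add: ennreal_mult'[symmetric] m'_def r'_def \<mu>_def s_def mult.commute)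
        then show "(\<integral>\<^sup>+y. F ((x, y), t) * ?n 0 1 (y - t * a x - u x) \<partial>lborel) * ?n (m x) (1 / sqrt (r x)) t =
          (\<integral>\<^sup>+y. F ((x, y), t) * ?p (x, y) t * ?n (\<mu> x) (s x) y \<partial>lborel)"
          by (subst nn_integral_multc[symmetric]) (auto simp: mult.assoc)
      qed
      also have "\<dots> = (\<integral>\<^sup>+y. (\<integral>\<^sup>+t. F ((x, y), t) * ?p (x, y) t * ?n (\<mu> x) (s x) y \<partial>lborel) \<partial>lborel)"
        by (rule lborel_pair.Fubini') measurable
      also have "\<dots> = (\<integral>\<^sup>+y. (\<integral>\<^sup>+t. F ((x, y), t) * ?p (x, y) t \<partial>lborel) * ?n (\<mu> x) (s x) y \<partial>lborel)"
        by (intro nn_integral_cong nn_integral_multc) measurable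
      finally show "(\<integral>\<^sup>+t. ?G (X \<omega>, t) *
          ?n (m (X \<omega>)) (1 / sqrt (r (X \<omega>))) t \<partial>lborel) =
        (\<integral>\<^sup>+y. (\<integral>\<^sup>+t. F ((X \<omega>, y), t) * ?p (X \<omega>, y) t \<partial>lborel) * ?n (\<mu> (X \<omega>)) (s (X \<omega>)) y \<partial>lborel)"
        by (simp add: x_def)
    qed
    finally show ?thesis .
  qed
  show pred: "(\<integral>\<^sup>+\<omega>. F (X \<omega>, Y \<omega>) \<partial>M) =
      (\<integral>\<^sup>+\<omega>. (\<integral>\<^sup>+y. F (X \<omega>, y) * ?n (\<mu> (X \<omega>)) (s (X \<omega>)) y \<partial>lborel) \<partial>M)"
    if [measurable]: "F \<in> borel_measurable (N \<Otimes>\<^sub>M borel)" for F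
  proof -
    have "(\<integral>\<^sup>+t. F z * ?p z t \<partial>lborel) = F z" for z
      using r' by (cases z) (simp add: nn_integral_cmult nn_integral_normal_density r'_def)
    then show ?thesis using key[of "\<lambda>z. F (fst z)"] by simp
  qed
  show "gaussian_posterior M (N \<Otimes>\<^sub>M borel) (\<lambda>\<omega>. (X \<omega>, Y \<omega>)) \<theta> m' r'"
    unfolding gaussian_posterior_def
  proof
    fix F :: "('b \<times> real) \<times> real \<Rightarrow> ennreal" assume F[measurable]: "F \<in> borel_measurable ((N \<Otimes>\<^sub>M borel) \<Otimes>\<^sub>M borel)"
    show "(\<integral>\<^sup>+\<omega>. F ((X \<omega>, Y \<omega>), \<theta> \<omega>) \<partial>M) =
      (\<integral>\<^sup>+\<omega>. (\<integral>\<^sup>+t. F ((X \<omega>, Y \<omega>), t) * ?p (X \<omega>, Y \<omega>) t \<partial>lborel) \<partial>M)"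
      unfolding key[OF F] by (subst pred[symmetric]) simp_all
  qed
qed

text \<open>Re-encodes the observed past without loss, since \<open>p\<close> recovers it from its
  image under \<open>g\<close>. This serves to read a history paired with the next output as the
  longer history.\<close>

lemma gaussian_posterior_transport:
  fixes g :: "'b \<Rightarrow> 'c"
  assumes post: "gaussian_posterior M N X \<theta> m r"
    and X: "X \<in> M \<rightarrow>\<^sub>M N" and g[measurable]: "g \<in> N \<rightarrow>\<^sub>M N'" and pg: "\<And>x. x \<in> space N \<Longrightarrow> p (g x) = x"
  shows "gaussian_posterior M N' (\<lambda>\<omega>. g (X \<omega>)) \<theta> (\<lambda>z. m (p z)) (\<lambda>z. r (p z))"
  unfolding gaussian_posterior_def
proof
  fix F :: "'c \<times> real \<Rightarrow> ennreal" assume [measurable]: "F \<in> borel_measurable (N' \<Otimes>\<^sub>M borel)"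
  have "(\<integral>\<^sup>+\<omega>. F (g (X \<omega>), \<theta> \<omega>) \<partial>M) = (\<integral>\<^sup>+\<omega>. (\<lambda>z. F (g (fst z), snd z)) (X \<omega>, \<theta> \<omega>) \<partial>M)"
    by simp
  also have "\<dots> = (\<integral>\<^sup>+\<omega>. (\<integral>\<^sup>+x. (\<lambda>z. F (g (fst z), snd z)) (X \<omega>, x) *
      ennreal (normal_density (m (X \<omega>)) (1 / sqrt (r (X \<omega>))) x) \<partial>lborel) \<partial>M)"
    by (rule post[unfolded gaussian_posterior_def, rule_format]) measurable
  also have "\<dots> = (\<integral>\<^sup>+\<omega>. (\<integral>\<^sup>+x. F (g (X \<omega>), x) *
      ennreal (normal_density (m (p (g (X \<omega>)))) (1 / sqrt (r (p (g (X \<omega>))))) x) \<partial>lborel) \<partial>M)"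
    using pg measurable_space[OF X] by (intro nn_integral_cong) simp
  finally show "(\<integral>\<^sup>+\<omega>. F (g (X \<omega>), \<theta> \<omega>) \<partial>M) = \<dots>" .
qed

section \<open>Normal measure of sparse sets\<close>

lemma piecewise_continuous_borel_measurable:
  assumes "piecewise_continuous f"
  shows "f \<in> borel_measurable borel"
proof (rule borel_measurable_continuous_countable_exceptions)
  have "{x. \<not> isCont f x} = (\<Union>n. {x \<in> {- real n..real n}. \<not> isCont f x})"
  proof (intro subset_antisym subsetI)
    fix x assume x: "x \<in> {x. \<not> isCont f x}"
    obtain n where "\<bar>x\<bar> \<le> real n" using real_arch_simple by blast
    then have "x \<in> {- real n..real n}" by (simp add: abs_le_iff)
    with x show "x \<in> (\<Union>n. {x \<in> {- real n..real n}. \<not> isCont f x})" by blast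
  qed blast
  also have "countable \<dots>"
    using assms unfolding piecewise_continuous_def by (intro countable_UN countableI_type) (simp add: countable_finite)
  finally show "countable {x. \<not> isCont f x}" .
  show "continuous_on (- {x. \<not> isCont f x}) f"
    by (auto intro!: continuous_at_imp_continuous_on)
qed

text \<open>On the annulus \<open>k s \<le> \<bar>y - \<mu>\<bar> \<le> (k + 1) s\<close> the density is at most
  \<open>2\<^sup>1\<^sup>-\<^sup>k / s\<close>, because \<open>k\<^sup>2 / 2 \<ge> k - 1 / 2\<close>.\<close>

lemma normal_density_le_series:
  assumes s: "0 < s"
  shows "ennreal (normal_density \<mu> s y) \<le>
    (\<Sum>k. ennreal (2 * (1/2)^k / s) * indicator {\<mu> - real (Suc k) * s..\<mu> + real (Suc k) * s} y)"
proof -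
  define z where "z = \<bar>y - \<mu>\<bar> / s"
  define k where "k = nat \<lfloor>z\<rfloor>"
  have z0: "0 \<le> z" using s by (simp add: z_def)
  have k: "real k \<le> z" "z \<le> real (Suc k)" using z0 unfolding k_def by linarith+
  have "exp (- z\<^sup>2 / 2) \<le> exp (1/2 - real k)"
  proof -
    have "0 \<le> (real k - 1)\<^sup>2" by simp
    then have "real k - 1/2 \<le> (real k)\<^sup>2 / 2" by (simp add: power2_eq_square algebra_simps)
    also have "\<dots> \<le> z\<^sup>2 / 2" using k by (intro divide_right_mono power_mono) auto
    finally show ?thesis by simp
  qed
  also have "\<dots> = exp (1/2) * (exp (-1)) ^ k"
    by (simp add: exp_of_nat_mult[symmetric] exp_add[symmetric])
  also have "\<dots> \<le> 2 * (1/2)^k"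
  proof (intro mult_mono power_mono)
    have "exp (1/2) ^ 2 = exp (1::real)" by (simp flip: exp_of_nat_mult)
    also have "\<dots> \<le> 2 ^ 2" using exp_le by simp
    finally show "exp (1/2) \<le> (2::real)" by (rule power2_le_imp_le) simp
    have "2 \<le> exp (1::real)" using exp_ge_add_one_self[of 1] by simp
    then show "exp (-1) \<le> (1/2::real)" by (simp add: exp_minus field_simps)
  qed auto
  finally have e: "exp (- z\<^sup>2 / 2) \<le> 2 * (1/2)^k" .
  have "normal_density \<mu> s y = 1 / (sqrt (2 * pi) * s) * exp (- z\<^sup>2 / 2)"
    using s unfolding normal_density_def z_def by (simp add: real_sqrt_mult power_divide)
  also have "\<dots> \<le> 1 / s * (2 * (1/2)^k)"
  proof (intro mult_mono e)
    have "1 \<le> sqrt (2 * pi)" using pi_gt3 by simp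
    then show "1 / (sqrt (2 * pi) * s) \<le> 1 / s" using s by (simp add: field_simps)
  qed (use s in auto)
  finally have "ennreal (normal_density \<mu> s y) \<le> ennreal (2 * (1/2)^k / s)"
    by (intro ennreal_leI) (simp add: field_simps)
  also have "\<dots> = ennreal (2 * (1/2)^k / s) * indicator {\<mu> - real (Suc k) * s..\<mu> + real (Suc k) * s} y"
  proof -
    have "\<bar>y - \<mu>\<bar> \<le> real (Suc k) * s" using k(2) s unfolding z_def by (simp add: field_simps)
    then have "y \<in> {\<mu> - real (Suc k) * s..\<mu> + real (Suc k) * s}" by (simp add: abs_le_iff)
    then show ?thesis by simp
  qed
  also have "\<dots> \<le> (\<Sum>k. ennreal (2 * (1/2)^k / s) * indicator {\<mu> - real (Suc k) * s..\<mu> + real (Suc k) * s} y)"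
  proof -
    have "g k \<le> suminf g" for g :: "nat \<Rightarrow> ennreal"
      using sum_le_suminf[OF summableI, of "{k}" g] by simp
    then show ?thesis .
  qed
  finally show ?thesis .
qed

text \<open>Integrate the series bound for the density over \<open>S\<close>: the interval with
  index \<open>k\<close> has half-length \<open>(k + 1) * s\<close>, so its share is at most
  \<open>2 * b * (k + 1) / 2^k\<close>, and these add up to \<open>8 * b\<close>. With a density
  bound uniform over centres, the estimate holds whatever mean the control produces.\<close>

lemma normal_measure_le:
  assumes S[measurable]: "S \<in> sets lborel" and s: "0 < s" and b: "0 \<le> b"
    and le: "\<And>l. s \<le> l \<Longrightarrow> emeasure lborel (S \<inter> {\<mu> - l..\<mu> + l}) \<le> ennreal (b * l)"
  shows "(\<integral>\<^sup>+y. indicator S y * ennreal (normal_density \<mu> s y) \<partial>lborel) \<le> ennreal (8 * b)"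
proof -
  let ?I = "\<lambda>k. {\<mu> - real (Suc k) * s..\<mu> + real (Suc k) * s}"
  have sums: "(\<lambda>k. 2 * b * (real (Suc k) * (1/2)^k)) sums (2 * b * 4)"
    using sums_mult[OF geometric_deriv_sums[of "1/2::real"], of "2 * b"] by (simp add: power2_eq_square)
  have "(\<integral>\<^sup>+y. indicator S y * ennreal (normal_density \<mu> s y) \<partial>lborel) \<le>
    (\<integral>\<^sup>+y. (\<Sum>k. ennreal (2 * (1/2)^k / s) * indicator (S \<inter> ?I k) y) \<partial>lborel)"
  proof (rule nn_integral_mono)
    fix y
    show "indicator S y * ennreal (normal_density \<mu> s y) \<le> (\<Sum>k. ennreal (2 * (1/2)^k / s) * indicator (S \<inter> ?I k) y)"
      using normal_density_le_series[OF s, of \<mu> y] by (cases "y \<in> S") (simp_all add: indicator_inter_arith)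
  qed
  also have "\<dots> = (\<Sum>k. ennreal (2 * (1/2)^k / s) * emeasure lborel (S \<inter> ?I k))"
    by (subst nn_integral_suminf) (auto simp: nn_integral_cmult)
  also have "\<dots> \<le> (\<Sum>k. ennreal (2 * b * (real (Suc k) * (1/2)^k)))"
  proof (intro suminf_le summableI)
    fix k
    have "s \<le> real (Suc k) * s" using s by simp
    then have "ennreal (2 * (1/2)^k / s) * emeasure lborel (S \<inter> ?I k) \<le>
      ennreal (2 * (1/2)^k / s) * ennreal (b * (real (Suc k) * s))"
      by (intro mult_left_mono le) auto
    also have "\<dots> = ennreal (2 * b * (real (Suc k) * (1/2)^k))"
      using s b by (subst ennreal_mult[symmetric]) (auto simp: field_simps)
    finally show "ennreal (2 * (1/2)^k / s) * emeasure lborel (S \<inter> ?I k) \<le> ennreal (2 * b * (real (Suc k) * (1/2)^k))" .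
  qed
  also have "\<dots> = ennreal (2 * b * 4)"
    using b sums by (intro suminf_ennreal_eq) auto
  finally show ?thesis by (simp add: algebra_simps)
qed

text \<open>The density is at most \<open>1 / (2 * s)\<close> and the interval has length
  \<open>2 * e * s\<close>. The bound is free of the mean, so the control cannot influence
  it.\<close>

lemma normal_measure_small_ball_le:
  assumes s: "0 < s" and e: "0 \<le> e"
  shows "(\<integral>\<^sup>+y. indicator {y. \<bar>y\<bar> < e * s} y * ennreal (normal_density \<mu> s y) \<partial>lborel) \<le> ennreal e"
proof -
  have "(\<integral>\<^sup>+y. indicator {y. \<bar>y\<bar> < e * s} y * ennreal (normal_density \<mu> s y) \<partial>lborel) \<le>
    (\<integral>\<^sup>+y. ennreal (1 / (2 * s)) * indicator {- (e * s)..e * s} y \<partial>lborel)"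
  proof (rule nn_integral_mono)
    fix y
    have "2 \<le> sqrt (2 * pi)" using pi_gt3 by (intro real_le_rsqrt) simp
    then have "1 / (sqrt (2 * pi) * s) * exp (- (y - \<mu>)\<^sup>2 / (2 * s\<^sup>2)) \<le> 1 / (2 * s) * 1"
      using s by (intro mult_mono) (auto simp: field_simps)
    then have "normal_density \<mu> s y \<le> 1 / (2 * s)"
      using s unfolding normal_density_def by (simp add: real_sqrt_mult)
    then show "indicator {y. \<bar>y\<bar> < e * s} y * ennreal (normal_density \<mu> s y) \<le>
      ennreal (1 / (2 * s)) * indicator {- (e * s)..e * s} y"
      by (auto simp: indicator_def intro!: ennreal_leI)
  qed
  also have "\<dots> = ennreal (1 / (2 * s)) * ennreal (2 * (e * s))"
    using s e by (subst nn_integral_cmult_indicator) auto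
  also have "\<dots> = ennreal e" using s e by (simp add: field_simps flip: ennreal_mult)
  finally show ?thesis .
qed

lemma S4_measurable [measurable]:
  "f \<in> borel_measurable borel \<Longrightarrow> S4 f L \<in> sets borel"
  unfolding S4_def
proof -
  assume [measurable]: "f \<in> borel_measurable borel"
  have [measurable]: "(\<lambda>x. L * \<bar>x\<bar> ^ 4) \<in> borel_measurable borel"
    by (intro borel_measurable_continuous_onI continuous_intros)
  show "{x. \<bar>f x\<bar> < L * \<bar>x\<bar> ^ 4} \<in> sets borel" by measurable
qed

text \<open>Unpacks the Landau symbol into a bound for every single centre. The quotients never
  exceed 2, so the real-valued \<open>SUP\<close> is taken over a bounded set and dominates each of
  them. As \<open>S4\<close> is Borel, its Lebesgue measure is its \<open>lborel\<close>
  measure.\<close>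

lemma S4_density:
  assumes f: "f \<in> borel_measurable borel" and \<delta>: "0 < \<delta>"
    and O: "(\<lambda>l::real. SUP x. measure lebesgue (S4 f L \<inter> {x - l..x + l}) / l)
      \<in> O[at_top](\<lambda>l. 1 / (ln (ln l)) powr (1 + \<delta>))"
  obtains C l0 where "0 < C" "\<And>l x. l0 \<le> l \<Longrightarrow>
    emeasure lborel (S4 f L \<inter> {x - l..x + l}) \<le> ennreal (C / ln (ln l) powr (1 + \<delta>) * l)"
proof -
  note [measurable] = f
  have m: "emeasure lborel (S4 f L \<inter> {x - l..x + l}) = ennreal (measure lebesgue (S4 f L \<inter> {x - l..x + l}))"
    and le2: "measure lebesgue (S4 f L \<inter> {x - l..x + l}) / l \<le> 2" if "0 < l" for x l
  proof -
    have fin: "emeasure lborel (S4 f L \<inter> {x - l..x + l}) \<le> ennreal (2 * l)"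
      using emeasure_mono[of "S4 f L \<inter> {x - l..x + l}" "{x - l..x + l}" lborel] that by simp
    have "measure lebesgue (S4 f L \<inter> {x - l..x + l}) = measure lborel (S4 f L \<inter> {x - l..x + l})"
      by (simp add: measure_completion)
    then show *: "emeasure lborel (S4 f L \<inter> {x - l..x + l}) = ennreal (measure lebesgue (S4 f L \<inter> {x - l..x + l}))"
      using fin by (subst emeasure_eq_ennreal_measure) (auto simp: top_unique)
    show "measure lebesgue (S4 f L \<inter> {x - l..x + l}) / l \<le> 2"
      using fin that unfolding * by (simp add: field_simps)
  qed
  obtain C where C: "0 < C" and ev: "\<forall>\<^sub>F l in at_top.
      norm (SUP x. measure lebesgue (S4 f L \<inter> {x - l..x + l}) / l) \<le> C * norm (1 / (ln (ln l)) powr (1 + \<delta>))"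
    using O by (rule landau_o.bigE)
  obtain l1 where l1: "\<And>l. l1 \<le> l \<Longrightarrow>
      norm (SUP x. measure lebesgue (S4 f L \<inter> {x - l..x + l}) / l) \<le> C * norm (1 / (ln (ln l)) powr (1 + \<delta>))"
    using ev by (auto simp: eventually_at_top_linorder)
  show thesis
  proof (rule that[OF C])
    fix l x assume "max l1 1 \<le> l"
    then have l: "l1 \<le> l" "0 < l" by auto
    have "measure lebesgue (S4 f L \<inter> {x - l..x + l}) / l \<le> (SUP x. measure lebesgue (S4 f L \<inter> {x - l..x + l}) / l)"
      using le2[OF l(2)] by (intro cSUP_upper) (auto simp: bdd_above_def)
    also have "\<dots> \<le> C / ln (ln l) powr (1 + \<delta>)" using l1[OF l(1)] by simp
    finally show "emeasure lborel (S4 f L \<inter> {x - l..x + l}) \<le> ennreal (C / ln (ln l) powr (1 + \<delta>) * l)"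
      unfolding m[OF l(2)] using l by (intro ennreal_leI) (simp add: field_simps)
  qed
qed

text \<open>Otherwise the interval of half-length \<open>l\<close> starting at \<open>b\<close>
  would lie entirely in \<open>S4\<close>, with quotient 2, whereas the density bound tends to 0.
  This supplies the initial value.\<close>

lemma exists_large_outside_S4:
  assumes f: "f \<in> borel_measurable borel" and \<delta>: "0 < \<delta>"
    and le: "\<And>l x. l0 \<le> l \<Longrightarrow>
      emeasure lborel (S4 f L \<inter> {x - l..x + l}) \<le> ennreal (C / ln (ln l) powr (1 + \<delta>) * l)"
  shows "\<exists>x \<ge> b. x \<notin> S4 f L"
proof (rule ccontr)
  assume "\<not> (\<exists>x \<ge> b. x \<notin> S4 f L)"
  then have sub: "{b..} \<subseteq> S4 f L" by auto
  have "((\<lambda>l. C / ln (ln l) powr (1 + \<delta>)) \<longlongrightarrow> 0) at_top"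
    using \<delta> by real_asymp
  then have "\<forall>\<^sub>F l in at_top. C / ln (ln l) powr (1 + \<delta>) < 2"
    by (rule order_tendstoD) simp
  then have "\<forall>\<^sub>F l in at_top. C / ln (ln l) powr (1 + \<delta>) < 2 \<and> l0 \<le> l \<and> 0 < l"
    by (intro eventually_conj eventually_ge_at_top eventually_gt_at_top)
  then obtain l where l: "C / ln (ln l) powr (1 + \<delta>) < 2" "l0 \<le> l" "0 < l"
    using eventually_happens'[OF trivial_limit_at_top_linorder] by blast
  have "ennreal (2 * l) = emeasure lborel {b + l - l..b + l + l}" using l by simp
  also have "{b + l - l..b + l + l} = S4 f L \<inter> {b + l - l..b + l + l}" using sub by auto
  also have "emeasure lborel \<dots> \<le> ennreal (C / ln (ln l) powr (1 + \<delta>) * l)" by (rule le) fact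
  also have "\<dots> < ennreal (2 * l)"
    using l by (intro ennreal_lessI mult_strict_right_mono) auto
  finally show False by simp
qed

section \<open>Growth of the information\<close>

text \<open>\<open>information\<close> is the reciprocal of the posterior variance of the parameter, and
  \<open>innovation_sd\<close> the standard deviation of the next output given the past.\<close>

definition information :: "real \<Rightarrow> (real \<Rightarrow> real) \<Rightarrow> nat \<Rightarrow> (nat \<Rightarrow> real) \<Rightarrow> real" where
  "information P f t x = 1 / P + (\<Sum>i<t. (f (x i))\<^sup>2)"

abbreviation innovation_sd :: "real \<Rightarrow> (real \<Rightarrow> real) \<Rightarrow> nat \<Rightarrow> (nat \<Rightarrow> real) \<Rightarrow> real" where
  "innovation_sd P f t x \<equiv> sqrt (information P f (Suc t) x / information P f t x)"

lemma information_pos: "0 < P \<Longrightarrow> 0 < information P f t x"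
  unfolding information_def by (simp add: add_pos_nonneg sum_nonneg)

lemma information_Suc: "information P f (Suc t) x = information P f t x + (f (x t))\<^sup>2"
  unfolding information_def by simp

text \<open>Success at step \<open>i\<close>, read off the outputs up to time \<open>i + 1\<close>.
  The threshold is relative to the predicted spread, so violating the second condition has
  conditional probability at most \<open>1 / (i + N)^2\<close>; these bounds are summable, and the
  shift \<open>N\<close> makes their sum small.\<close>

definition escaping :: "real \<Rightarrow> (real \<Rightarrow> real) \<Rightarrow> real \<Rightarrow> nat \<Rightarrow> nat \<Rightarrow> (nat \<Rightarrow> real) \<Rightarrow> bool" where
  "escaping P f L N i x \<longleftrightarrow>
     x (Suc i) \<notin> S4 f L \<and> 1 / (real (i + N))\<^sup>2 * innovation_sd P f i x \<le> \<bar>x (Suc i)\<bar>"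

text \<open>Outside \<open>S4\<close> the square of \<open>f\<close> at the new output
  \<open>y\<close> is at least \<open>L^2 * |y|^8\<close>, and it is a summand of the next
  information. Inserting the lower bound for \<open>|y|\<close> and taking logarithms, the eighth
  power of a square root gives the factor 4, and the eighth power of \<open>(t + N)^2\<close> gives
  the factor 16.\<close>

lemma escaping_ln_information:
  fixes t :: nat
  assumes P: "0 < P" and L: "0 < L" and N: "1 \<le> N" and esc: "escaping P f L N t x"
  shows "4 * (ln (information P f (Suc t) x) - ln (information P f t x)) + 2 * ln L - 16 * ln (real (t + N))
    \<le> ln (information P f (Suc (Suc t)) x)"
proof -
  let ?R = "\<lambda>t. information P f t x"
  let ?n = "real (t + N)"
  have R: "0 < ?R t" for t using P by (rule information_pos)
  have n: "0 < ?n" using N by simp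
  have "L * \<bar>x (Suc t)\<bar> ^ 4 \<le> \<bar>f (x (Suc t))\<bar>" using esc by (simp add: escaping_def S4_def)
  moreover have "(1 / ?n\<^sup>2 * sqrt (?R (Suc t) / ?R t)) ^ 4 \<le> \<bar>x (Suc t)\<bar> ^ 4"
    using esc R n by (intro power_mono) (auto simp: escaping_def less_imp_le)
  ultimately have "L * (1 / ?n\<^sup>2 * sqrt (?R (Suc t) / ?R t)) ^ 4 \<le> \<bar>f (x (Suc t))\<bar>"
    using L by (meson mult_left_mono less_imp_le order_trans)
  then have "(L * (1 / ?n\<^sup>2 * sqrt (?R (Suc t) / ?R t)) ^ 4)\<^sup>2 \<le> \<bar>f (x (Suc t))\<bar>\<^sup>2"
    using L by (intro power_mono) auto
  also have "\<dots> \<le> ?R (Suc (Suc t))" using R[of "Suc t"] by (simp add: information_Suc)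
  finally have *: "(L * (1 / ?n\<^sup>2 * sqrt (?R (Suc t) / ?R t)) ^ 4)\<^sup>2 \<le> ?R (Suc (Suc t))" .
  have p: "0 < 1 / ?n\<^sup>2 * sqrt (?R (Suc t) / ?R t)" using n R by simp
  have "ln (1 / ?n\<^sup>2 * sqrt (?R (Suc t) / ?R t)) = ln (1 / ?n\<^sup>2) + ln (sqrt (?R (Suc t) / ?R t))"
    using n R by (intro ln_mult_pos) auto
  also have "\<dots> = (ln (?R (Suc t)) - ln (?R t)) / 2 - 2 * ln ?n"
    using n R[of t] R[of "Suc t"] by (simp add: ln_sqrt ln_divide_pos ln_inverse ln_realpow divide_inverse[of 1])
  finally have ln_x: "ln (1 / ?n\<^sup>2 * sqrt (?R (Suc t) / ?R t)) = \<dots>" .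
  have "ln ((L * (1 / ?n\<^sup>2 * sqrt (?R (Suc t) / ?R t)) ^ 4)\<^sup>2) =
    2 * (ln L + 4 * ln (1 / ?n\<^sup>2 * sqrt (?R (Suc t) / ?R t)))"
    using p L by (simp only: ln_realpow ln_mult_pos zero_less_power mult_pos_pos of_nat_numeral)
  also have "\<dots> = 4 * (ln (?R (Suc t)) - ln (?R t)) + 2 * ln L - 16 * ln ?n"
    unfolding ln_x by simp
  finally show ?thesis
    using * p L R by (metis ln_le_cancel_iff mult_pos_pos zero_less_power)
qed

text \<open>With \<open>a\<^sub>t\<close> the logarithm of the information, escaping gives \<open>a\<^sub>t\<^sub>+\<^sub>2 \<ge> 4 a\<^sub>t\<^sub>+\<^sub>1 - 4 a\<^sub>t - O(log t)\<close>.
  The exponent 4 makes the characteristic polynomial \<open>(z - 2)\<^sup>2\<close>, so the defect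
  \<open>a\<^sub>t\<^sub>+\<^sub>1 - 2 a\<^sub>t\<close> essentially doubles at every step.\<close>

lemma escaping_growth:
  fixes t :: nat
  assumes P: "0 < P" and L: "0 < L" and N: "1 \<le> N"
    and init: "K + 16 * real N + 2 * \<bar>ln L\<bar> \<le>
      ln (information P f (Suc 0) x) - 2 * ln (information P f 0 x)"
    and K: "0 \<le> K"
    and esc: "\<And>i. i < t \<Longrightarrow> escaping P f L N i x"
  shows "2 ^ t * (K + ln (information P f 0 x)) \<le> ln (information P f (Suc t) x / information P f t x)"
proof -
  define a where "a t = ln (information P f t x)" for t
  \<comment> \<open>For the defect \<open>d t = a (Suc t) - 2 * a t\<close> escaping reads
    \<open>d (t + 1) \<ge> 2 * d t + 2 * ln L - 16 * ln (t + N)\<close>. Doubling the reserve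
    \<open>16 * (t + N) + 2 * |ln L|\<close> pays for both errors and, by
    \<open>ln n \<le> n - 1\<close>, leaves the reserve for \<open>t + 1\<close>. The logarithm of
    the information ratio is \<open>d t + a t\<close>.\<close>
  have inv: "2 ^ t * K + 16 * real (t + N) + 2 * \<bar>ln L\<bar> \<le> a (Suc t) - 2 * a t \<and> 2 ^ t * a 0 \<le> a t"
    using esc
  proof (induction t)
    case 0
    then show ?case using init by (simp add: a_def)
  next
    case (Suc t)
    then have IH: "2 ^ t * K + 16 * real (t + N) + 2 * \<bar>ln L\<bar> \<le> a (Suc t) - 2 * a t" "2 ^ t * a 0 \<le> a t"
      by auto
    have "4 * (a (Suc t) - a t) + 2 * ln L - 16 * ln (real (t + N)) \<le> a (Suc (Suc t))"
      unfolding a_def using Suc.prems by (intro escaping_ln_information P L N) auto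
    moreover have "ln (real (t + N)) \<le> real (t + N) - 1" using N by (intro ln_le_minus_one) auto
    moreover have "0 \<le> 2 ^ t * K" using K by simp
    ultimately show ?case using IH by (simp add: algebra_simps) linarith
  qed
  have "ln (information P f (Suc t) x / information P f t x) = a (Suc t) - a t"
    unfolding a_def by (intro ln_divide_pos information_pos P)
  with inv N show ?thesis unfolding a_def[symmetric] by (simp add: algebra_simps) linarith
qed

text \<open>Lets finite histories and the full output sequence be interchanged.\<close>

lemma escaping_cong:
  assumes "\<And>j. j \<le> Suc i \<Longrightarrow> x j = x' j"
  shows "escaping P f L N i x \<longleftrightarrow> escaping P f L N i x'"
proof -
  have "information P f k x = information P f k x'" if "k \<le> Suc i" for k
    using assms that by (auto simp: information_def)
  then show ?thesis using assms by (simp add: escaping_def)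
qed

text \<open>The growth estimate with \<open>K = 2 * 2 ^ N + |ln P|\<close>. The initial logarithm of
  the information is \<open>- ln P\<close>, so \<open>K\<close> plus this value is at least
  \<open>2 * 2 ^ N\<close>; the factor 2 is spent on the square root in
  \<open>innovation_sd\<close>.\<close>

lemma escaping_innovation_sd:
  fixes x :: "nat \<Rightarrow> real"
  assumes P: "0 < P" and L: "0 < L" and N: "1 \<le> N"
    and init: "2 * 2 ^ N + \<bar>ln P\<bar> + 16 * real N + 2 * \<bar>ln L\<bar> - 2 * ln P \<le> ln (1 / P + (f (x 0))\<^sup>2)"
    and esc: "\<And>i. i < t \<Longrightarrow> escaping P f L N i x"
  shows "exp (2 ^ (t + N)) \<le> innovation_sd P f t x"
proof -
  let ?q = "information P f (Suc t) x / information P f t x"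
  have a0: "ln (information P f 0 x) = - ln P" using P by (simp add: information_def ln_div)
  have "2 ^ t * (2 * 2 ^ N + \<bar>ln P\<bar> + ln (information P f 0 x)) \<le> ln ?q"
  proof (rule escaping_growth[OF P L N])
    show "2 * 2 ^ N + \<bar>ln P\<bar> + 16 * real N + 2 * \<bar>ln L\<bar> \<le>
      ln (information P f (Suc 0) x) - 2 * ln (information P f 0 x)"
      using init unfolding a0 by (simp add: information_def)
  qed (use esc in auto)
  moreover have "2 ^ t * (2 * 2 ^ N) \<le> (2 ^ t * (2 * 2 ^ N + \<bar>ln P\<bar> + ln (information P f 0 x)) :: real)"
    by (intro mult_left_mono) (auto simp: a0)
  moreover have "2 * 2 ^ (t + N) = (2 ^ t * (2 * 2 ^ N) :: real)" by (simp add: power_add)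
  ultimately have "2 * 2 ^ (t + N) \<le> ln ?q" by linarith
  moreover have q: "0 < ?q" using information_pos[OF P] by simp
  ultimately have "exp (2 * 2 ^ (t + N)) \<le> ?q" by (simp add: ln_ge_iff)
  then show ?thesis by (intro real_le_rsqrt) (simp add: exp_double)
qed

text \<open>The last square alone makes the average large. With \<open>n = t + N\<close> it is at
  least \<open>exp (2 ^ n)^2 / n^4\<close>, and dividing by the time \<open>t + 1 \<le> n\<close>
  costs one more power, whence the exponent 5.\<close>

lemma average_unbounded:
  fixes x :: "nat \<Rightarrow> real"
  assumes N: "1 \<le> N" and le: "\<And>t. exp (2 ^ (t + N)) / (real (t + N))\<^sup>2 \<le> \<bar>x (Suc t)\<bar>"
  shows "limsup (\<lambda>t. ereal (1 / real t * (\<Sum>i = 1..t. (x i)\<^sup>2))) = \<infinity>"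
proof -
  have "filterlim (\<lambda>n::nat. (exp (2 ^ n))\<^sup>2 / real n ^ 5) at_top at_top"
    by real_asymp
  then have f: "filterlim (\<lambda>t. (exp (2 ^ (t + N)))\<^sup>2 / real (t + N) ^ 5) at_top at_top"
    by (rule filterlim_compose) (simp add: filterlim_add_const_nat_at_top)
  have "filterlim (\<lambda>t. 1 / real (Suc t) * (\<Sum>i = 1..Suc t. (x i)\<^sup>2)) at_top at_top"
  proof (rule filterlim_at_top_mono[OF f], rule always_eventually, rule allI)
    fix t
    let ?e = "exp (2 ^ (t + N)) :: real" and ?n = "real (t + N)"
    have n: "0 < ?n" "real (Suc t) \<le> ?n" using N by auto
    have "?e\<^sup>2 / ?n ^ 5 = 1 / ?n * (?e / ?n\<^sup>2)\<^sup>2"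
      by (simp add: power_divide power_mult[symmetric]) (simp add: eval_nat_numeral)
    also have "\<dots> \<le> 1 / real (Suc t) * (x (Suc t))\<^sup>2"
    proof (intro mult_mono)
      show "(?e / ?n\<^sup>2)\<^sup>2 \<le> (x (Suc t))\<^sup>2"
        using le[of t] by (intro abs_le_square_iff[THEN iffD1]) simp
    qed (use n in \<open>auto simp: field_simps\<close>)
    also have "\<dots> \<le> 1 / real (Suc t) * (\<Sum>i = 1..Suc t. (x i)\<^sup>2)"
      by (intro mult_left_mono member_le_sum) auto
    finally show "?e\<^sup>2 / ?n ^ 5 \<le> 1 / real (Suc t) * (\<Sum>i = 1..Suc t. (x i)\<^sup>2)" .
  qed
  then have "filterlim (\<lambda>t. 1 / real t * (\<Sum>i = 1..t. (x i)\<^sup>2)) at_top at_top"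
    by (subst filterlim_sequentially_Suc[symmetric])
  then have "(\<lambda>t. ereal (1 / real t * (\<Sum>i = 1..t. (x i)\<^sup>2))) \<longlonglongrightarrow> \<infinity>"
    by (simp add: tendsto_PInfty_eq_at_top)
  then show ?thesis by (intro lim_imp_Limsup) auto
qed

section \<open>The closed loop\<close>

text \<open>The sequence \<open>v\<close> collects all randomness: \<open>v 0\<close> is the parameter and \<open>v 1, v 2, \<dots>\<close>
  is the noise.\<close>

primrec trajectory ::
  "(real \<Rightarrow> real) \<Rightarrow> (nat \<Rightarrow> (nat \<Rightarrow> real) \<Rightarrow> real) \<Rightarrow> real \<Rightarrow> (nat \<Rightarrow> real) \<Rightarrow> nat \<Rightarrow> nat \<Rightarrow> real" where
  "trajectory f h c v 0 = (\<lambda>i\<in>{..0}. c)"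
| "trajectory f h c v (Suc t) = (trajectory f h c v t)
     (Suc t := v 0 * f (trajectory f h c v t t) + h t (trajectory f h c v t) + v (Suc t))"

lemma trajectory_0: "trajectory f h c v t 0 = c"
  by (induction t) simp_all

lemma trajectory_le: "i \<le> t \<Longrightarrow> trajectory f h c v t i = trajectory f h c v i i"
  by (induction t) (auto simp: le_Suc_eq)

lemma trajectory_extensional: "trajectory f h c v t \<in> extensional {..t}"
  by (induction t) (auto simp: extensional_def)

lemma trajectory_cong: "(\<And>i. i \<le> t \<Longrightarrow> v i = v' i) \<Longrightarrow> trajectory f h c v t = trajectory f h c v' t"
  by (induction t) auto

text \<open>Outputs are the diagonal entries of the trajectory, since extending a trajectory only
  adds a coordinate. Both sides agree as functions because both are \<open>undefined\<close> beyond
  \<open>t\<close>.\<close>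

lemma history_trajectory:
  "history (\<lambda>t \<omega>. trajectory f h c (v \<omega>) t t) t \<omega> = trajectory f h c (v \<omega>) t"
proof
  fix i
  show "history (\<lambda>t \<omega>. trajectory f h c (v \<omega>) t t) t \<omega> i = trajectory f h c (v \<omega>) t i"
    using trajectory_extensional[of f h c "v \<omega>" t] trajectory_le[of i t f h c "v \<omega>"]
    by (cases "i \<le> t") (auto simp: history_def extensional_def)
qed

section \<open>Measurability of the trajectory and independence of the noise\<close>

lemma measurable_history_extend:
  "(\<lambda>z. (fst z)(Suc t := snd z)) \<in> (\<Pi>\<^sub>M i\<in>{..t}. borel) \<Otimes>\<^sub>M (borel :: real measure) \<rightarrow>\<^sub>M (\<Pi>\<^sub>M i\<in>{..Suc t}. borel)"
  using measurable_add_dim[of "Suc t" "{..t}" "\<lambda>_. borel :: real measure"]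
  by (simp add: atMost_Suc case_prod_beta')

lemma measurable_trajectory:
  assumes h: "feedback_law h" and f[measurable]: "f \<in> borel_measurable borel"
    and v: "\<And>i. i \<le> t \<Longrightarrow> (\<lambda>\<omega>. v \<omega> i) \<in> borel_measurable M"
  shows "(\<lambda>\<omega>. trajectory f h c (v \<omega>) t) \<in> M \<rightarrow>\<^sub>M (\<Pi>\<^sub>M i\<in>{..t}. borel)"
  using v
proof (induction t)
  case 0
  show ?case unfolding trajectory.simps by (rule measurable_restrict) simp
next
  case (Suc t)
  have [measurable]: "(\<lambda>\<omega>. v \<omega> 0) \<in> borel_measurable M" "(\<lambda>\<omega>. v \<omega> (Suc t)) \<in> borel_measurable M"
    using Suc.prems by auto
  have X: "(\<lambda>\<omega>. trajectory f h c (v \<omega>) t) \<in> M \<rightarrow>\<^sub>M (\<Pi>\<^sub>M i\<in>{..t}. borel)"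
    using Suc by auto
  have [measurable]: "(\<lambda>\<omega>. trajectory f h c (v \<omega>) t t) \<in> borel_measurable M"
    by (rule measurable_compose[OF X measurable_component_singleton]) simp
  have [measurable]: "(\<lambda>\<omega>. h t (trajectory f h c (v \<omega>) t)) \<in> borel_measurable M"
    by (rule measurable_compose[OF X]) (use h in \<open>simp add: feedback_law_def\<close>)
  have "(\<lambda>\<omega>. (trajectory f h c (v \<omega>) t, v \<omega> 0 * f (trajectory f h c (v \<omega>) t t) +
      h t (trajectory f h c (v \<omega>) t) + v \<omega> (Suc t))) \<in> M \<rightarrow>\<^sub>M (\<Pi>\<^sub>M i\<in>{..t}. borel) \<Otimes>\<^sub>M borel"
    by (intro measurable_Pair X) measurable
  from measurable_compose[OF this measurable_history_extend] show ?case
    by (simp only: trajectory.simps fst_conv snd_conv)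
qed

text \<open>The bound is \<open>Suc n\<close> rather than \<open>n\<close> because
  \<open>information\<close> at time \<open>t\<close> reads only the outputs before
  \<open>t\<close>.\<close>

lemma measurable_information:
  assumes [measurable]: "f \<in> borel_measurable borel" and "t \<le> Suc n"
  shows "information P f t \<in> borel_measurable (\<Pi>\<^sub>M i\<in>{..n}. borel)"
proof -
  have [measurable]: "(\<lambda>x. x i) \<in> borel_measurable (\<Pi>\<^sub>M i\<in>{..n}. borel)" if "i < t" for i
    using that assms(2) by (intro measurable_component_singleton) auto
  show ?thesis unfolding information_def[abs_def] by measurable
qed

text \<open>Freezing the past: \<open>v (Suc t)\<close> is independent of
  \<open>v 0, ..., v t\<close>, so the joint law is a product and the new noise can be integrated
  against its density. The map \<Phi> allows any measurable functional of the past.\<close>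

lemma (in prob_space) indep_vars_Suc_noise:
  fixes v :: "nat \<Rightarrow> 'a \<Rightarrow> real" and F :: "'b \<times> real \<Rightarrow> ennreal"
  assumes indep: "indep_vars (\<lambda>_. borel) v UNIV"
    and dist: "distributed M lborel (v (Suc t)) (\<lambda>x. ennreal (g x))"
    and \<Phi>[measurable]: "\<Phi> \<in> (\<Pi>\<^sub>M i\<in>{..t}. borel) \<rightarrow>\<^sub>M Q"
    and F[measurable]: "F \<in> borel_measurable (Q \<Otimes>\<^sub>M borel)"
  shows "(\<integral>\<^sup>+\<omega>. F (\<Phi> (\<lambda>i\<in>{..t}. v i \<omega>), v (Suc t) \<omega>) \<partial>M) =
    (\<integral>\<^sup>+\<omega>. (\<integral>\<^sup>+z. F (\<Phi> (\<lambda>i\<in>{..t}. v i \<omega>), z) * ennreal (g z) \<partial>lborel) \<partial>M)"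
proof -
  let ?A = "\<Pi>\<^sub>M i\<in>{..t}. (borel :: real measure)" and ?B = "\<Pi>\<^sub>M i\<in>{Suc t}. (borel :: real measure)"
  let ?V = "\<lambda>\<omega>. \<lambda>i\<in>{..t}. v i \<omega>" and ?W = "\<lambda>\<omega>. \<lambda>i\<in>{Suc t}. v i \<omega>"
  have ind: "indep_var ?A ?V ?B ?W" by (rule indep_var_restrict[OF indep]) auto
  have V[measurable]: "?V \<in> M \<rightarrow>\<^sub>M ?A" and W[measurable]: "?W \<in> M \<rightarrow>\<^sub>M ?B"
    using ind by (auto dest: indep_var_rv1 indep_var_rv2)
  interpret W: prob_space "distr M ?B ?W" by (rule prob_space_distr) simp
  let ?G = "\<lambda>p. F (\<Phi> (fst p), snd p (Suc t))"
  have [measurable]: "(\<lambda>x. x (Suc t)) \<in> borel_measurable ?B"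
    by (intro measurable_component_singleton) auto
  have [measurable]: "?G \<in> borel_measurable (?A \<Otimes>\<^sub>M ?B)"
    by measurable
  have "(\<integral>\<^sup>+\<omega>. F (\<Phi> (?V \<omega>), v (Suc t) \<omega>) \<partial>M) = (\<integral>\<^sup>+\<omega>. ?G (?V \<omega>, ?W \<omega>) \<partial>M)"
    by simp
  also have "\<dots> = (\<integral>\<^sup>+p. ?G p \<partial>distr M (?A \<Otimes>\<^sub>M ?B) (\<lambda>\<omega>. (?V \<omega>, ?W \<omega>)))"
    by (subst nn_integral_distr) auto
  also have "\<dots> = (\<integral>\<^sup>+p. ?G p \<partial>(distr M ?A ?V \<Otimes>\<^sub>M distr M ?B ?W))"
    using ind by (simp add: indep_var_distribution_eq)
  also have "\<dots> = (\<integral>\<^sup>+x. (\<integral>\<^sup>+z. ?G (x, z) \<partial>distr M ?B ?W) \<partial>distr M ?A ?V)"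
    by (rule W.nn_integral_fst[symmetric]) simp
  also have "\<dots> = (\<integral>\<^sup>+x. (\<integral>\<^sup>+\<omega>. F (\<Phi> x, v (Suc t) \<omega>) \<partial>M) \<partial>distr M ?A ?V)"
    by (intro nn_integral_cong) (subst nn_integral_distr, auto)
  also have "\<dots> = (\<integral>\<^sup>+x. (\<integral>\<^sup>+z. F (\<Phi> x, z) * ennreal (g z) \<partial>lborel) \<partial>distr M ?A ?V)"
  proof (intro nn_integral_cong)
    fix x assume "x \<in> space (distr M ?A ?V)"
    then have "\<Phi> x \<in> space Q" using measurable_space[OF \<Phi>] by simp
    then show "(\<integral>\<^sup>+\<omega>. F (\<Phi> x, v (Suc t) \<omega>) \<partial>M) = (\<integral>\<^sup>+z. F (\<Phi> x, z) * ennreal (g z) \<partial>lborel)"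
      by (subst distributed_nn_integral[OF dist, symmetric]) (auto simp: mult.commute)
  qed
  also have "\<dots> = (\<integral>\<^sup>+\<omega>. (\<integral>\<^sup>+z. F (\<Phi> (?V \<omega>), z) * ennreal (g z) \<partial>lborel) \<partial>M)"
    using distributed_borel_measurable[OF dist]
    by (subst nn_integral_distr) auto
  finally show ?thesis .
qed

text \<open>It suffices to check the product rule on finite index sets \<open>J\<close>. If
  \<open>J\<close> contains 0 and other indices, the events of those others form one event of the
  whole noise sequence; independence of \<theta> from the sequence splits off index 0, and
  independence within the noise handles the rest.\<close>

lemma (in prob_space) indep_vars_Cons:
  fixes \<theta> :: "'a \<Rightarrow> real" and w :: "nat \<Rightarrow> 'a \<Rightarrow> real"
  assumes w: "indep_vars (\<lambda>_. borel) w {1..}"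
    and \<theta>: "indep_rv M borel \<theta> (\<Pi>\<^sub>M t\<in>{1..}. borel) (\<lambda>\<omega>. \<lambda>t\<in>{1..}. w t \<omega>)"
  shows "indep_vars (\<lambda>_. borel) (\<lambda>i. if i = 0 then \<theta> else w i) UNIV"
proof -
  let ?v = "\<lambda>i. if i = 0 then \<theta> else w i"
  have rv: "?v i \<in> borel_measurable M" for i
    using w \<theta> by (auto simp: indep_vars_def indep_rv_def)
  show ?thesis
    unfolding indep_vars_def2
  proof (intro conjI ballI rv indep_setsI)
    fix i :: nat
    show "{?v i -` A \<inter> space M |A. A \<in> sets borel} \<subseteq> events"
      using rv[of i] by (auto simp del: if_split_asm intro: measurable_sets)
  next
    fix A and J :: "nat set"
    assume J: "J \<noteq> {}" "finite J" and "\<forall>j\<in>J. A j \<in> {?v j -` B \<inter> space M |B. B \<in> sets borel}"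
    then have "\<forall>j\<in>J. \<exists>B. B \<in> sets borel \<and> A j = ?v j -` B \<inter> space M" by blast
    then obtain B where B: "\<And>j. j \<in> J \<Longrightarrow> B j \<in> sets borel" "\<And>j. j \<in> J \<Longrightarrow> A j = ?v j -` B j \<inter> space M"
      by (metis (no_types))
    define J' where "J' = J - {0}"
    have J': "finite J'" "J' \<subseteq> {1..}" using J by (auto simp: J'_def)
    have ne: "prob (\<Inter>j\<in>J'. A j) = (\<Prod>j\<in>J'. prob (A j))" if "J' \<noteq> {}"
    proof (rule indep_setsD)
      show "indep_sets (\<lambda>i. {w i -` A \<inter> space M | A. A \<in> sets borel}) {1..}"
        using w by (simp add: indep_vars_def2)
      show "\<forall>j\<in>J'. A j \<in> {w j -` A \<inter> space M | A. A \<in> sets borel}"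
        using B by (auto simp: J'_def)
    qed (use that J' in auto)
    show "prob (\<Inter>j\<in>J. A j) = (\<Prod>j\<in>J. prob (A j))"
    proof (cases "0 \<in> J \<and> J' \<noteq> {}")
      case False
      then consider "J = J'" | "J = {0}" using J by (auto simp: J'_def)
      then show ?thesis using ne J by cases auto
    next
      case True
      then have J_eq: "J = insert 0 J'" "0 \<notin> J'" by (auto simp: J'_def)
      let ?P = "\<Pi>\<^sub>M t\<in>{1::nat..}. (borel :: real measure)" and ?W = "\<lambda>\<omega>. \<lambda>t\<in>{1..}. w t \<omega>"
      have "prob (A 0 \<inter> (\<Inter>j\<in>J'. A j)) = prob (A 0) * prob (\<Inter>j\<in>J'. A j)"
      proof (rule indep_setD)
        show "indep_set (sets (vimage_algebra (space M) \<theta> borel)) (sets (vimage_algebra (space M) ?W ?P))"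
          using \<theta> by (simp add: indep_rv_def)
        show "A 0 \<in> sets (vimage_algebra (space M) \<theta> borel)"
          using B[of 0] True by (auto intro: in_vimage_algebra)
        have "(\<Inter>j\<in>J'. A j) = ?W -` (\<Inter>j\<in>J'. (\<lambda>x. x j) -` B j \<inter> space ?P) \<inter> space M"
        proof -
          have "(\<Inter>j\<in>J'. A j) = (\<Inter>j\<in>J'. w j -` B j \<inter> space M)"
            using B(2) by (intro INF_cong) (auto simp: J'_def)
          also have "\<dots> = ?W -` (\<Inter>j\<in>J'. (\<lambda>x. x j) -` B j \<inter> space ?P) \<inter> space M"
          proof -
            have "?W \<omega> \<in> space ?P" for \<omega> by (simp add: space_PiM)
            moreover have "?W \<omega> j = w j \<omega>" if "j \<in> J'" for j \<omega> using that J' by auto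
            ultimately have "\<omega> \<in> w j -` B j \<inter> space M \<longleftrightarrow> \<omega> \<in> space M \<and> ?W \<omega> \<in> (\<lambda>x. x j) -` B j \<inter> space ?P"
              if "j \<in> J'" for j \<omega> using that by auto
            then show ?thesis using True by blast
          qed
          finally show ?thesis .
        qed
        moreover have "(\<Inter>j\<in>J'. (\<lambda>x. x j) -` B j \<inter> space ?P) \<in> sets ?P"
          using True J' B J_eq
          by (intro sets.finite_INT measurable_sets[OF measurable_component_singleton]) auto
        ultimately show "(\<Inter>j\<in>J'. A j) \<in> sets (vimage_algebra (space M) ?W ?P)"
          by (simp only: in_vimage_algebra)
      qed
      then show ?thesis using ne True J' J_eq by simp
    qed
  qed
qed

text \<open>A constant generates only the empty event and the whole space. In this way a
  deterministic initial value meets the independence requirement.\<close>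

lemma (in prob_space) indep_rv_const:
  assumes "c \<in> space S" "Y \<in> M \<rightarrow>\<^sub>M T"
  shows "indep_rv M S (\<lambda>_. c) T Y"
  unfolding indep_rv_def
proof (intro conjI indep_setI)
  have *: "A = {} \<or> A = space M" if "A \<in> sets (vimage_algebra (space M) (\<lambda>_. c) S)" for A
  proof -
    obtain B where "A = (\<lambda>_. c) -` B \<inter> space M"
      using \<open>A \<in> _\<close> assms(1) by (auto simp: sets_vimage_algebra2)
    then show ?thesis by (cases "c \<in> B") auto
  qed
  then show "sets (vimage_algebra (space M) (\<lambda>_. c) S) \<subseteq> events" by auto
  show Y: "sets (vimage_algebra (space M) Y T) \<subseteq> events"
    using assms(2) measurable_space[OF assms(2)]
    by (subst sets_vimage_algebra2) (auto intro: measurable_sets)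
  fix a b assume "a \<in> sets (vimage_algebra (space M) (\<lambda>_. c) S)" "b \<in> sets (vimage_algebra (space M) Y T)"
  then show "prob (a \<inter> b) = prob a * prob b"
    using *[of a] Y sets.sets_into_space[of b M] by (auto simp: prob_space Int_absorb1)
qed (use assms in auto)

lemma distributed_cong_distr:
  assumes "distributed M N X g" "Y \<in> M \<rightarrow>\<^sub>M N" "distr M N Y = distr M N X"
  shows "distributed M N Y g"
  using assms unfolding distributed_def by simp

section \<open>Conditional laws along the closed-loop trajectory\<close>

context prob_space
begin

context
  fixes f :: "real \<Rightarrow> real" and h :: "nat \<Rightarrow> (nat \<Rightarrow> real) \<Rightarrow> real" and c \<theta>0 P :: real
    and v :: "nat \<Rightarrow> 'a \<Rightarrow> real" and X :: "nat \<Rightarrow> 'a \<Rightarrow> nat \<Rightarrow> real"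
  assumes f[measurable]: "f \<in> borel_measurable borel" and h: "feedback_law h" and P: "0 < P"
    and indep: "indep_vars (\<lambda>_. borel) v UNIV"
    and parameter: "distributed M lborel (v 0) (normal_density \<theta>0 (sqrt P))"
    and noise: "\<And>t. distributed M lborel (v (Suc t)) (normal_density 0 1)"
  defines "X \<equiv> \<lambda>t \<omega>. trajectory f h c (\<lambda>i. v i \<omega>) t"
begin

lemma v_measurable [measurable]: "v i \<in> borel_measurable M"
  using indep by (simp add: indep_vars_def)

lemma h_measurable [measurable]: "h t \<in> borel_measurable (\<Pi>\<^sub>M i\<in>{..t}. borel)"
  using h by (simp add: feedback_law_def)

lemma X_measurable [measurable]: "X t \<in> M \<rightarrow>\<^sub>M (\<Pi>\<^sub>M i\<in>{..t}. borel)"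
  unfolding X_def by (intro measurable_trajectory h f) simp

lemma X_Suc: "X (Suc t) \<omega> = (X t \<omega>)(Suc t := v 0 \<omega> * f (X t \<omega> t) + h t (X t \<omega>) + v (Suc t) \<omega>)"
  by (simp add: X_def)

lemma state_measurable: "(\<lambda>x. x t) \<in> borel_measurable (\<Pi>\<^sub>M i\<in>{..t::nat}. borel)"
  by (intro measurable_component_singleton) auto

text \<open>\<open>X t\<close> and the parameter are functions of \<open>v 0, ..., v t\<close>
  alone, so the next noise can be integrated out with both of them frozen.\<close>

lemma noise_step:
  assumes "F \<in> borel_measurable (((\<Pi>\<^sub>M i\<in>{..t}. borel) \<Otimes>\<^sub>M borel) \<Otimes>\<^sub>M borel)"
  shows "(\<integral>\<^sup>+\<omega>. F ((X t \<omega>, v 0 \<omega>), v (Suc t) \<omega>) \<partial>M) =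
    (\<integral>\<^sup>+\<omega>. (\<integral>\<^sup>+z. F ((X t \<omega>, v 0 \<omega>), z) * ennreal (normal_density 0 1 z) \<partial>lborel) \<partial>M)"
proof -
  let ?\<Phi> = "\<lambda>x. (trajectory f h c x t, x 0)"
  have "?\<Phi> \<in> (\<Pi>\<^sub>M i\<in>{..t}. borel) \<rightarrow>\<^sub>M (\<Pi>\<^sub>M i\<in>{..t}. borel) \<Otimes>\<^sub>M borel"
    by (intro measurable_Pair measurable_trajectory h f measurable_component_singleton) auto
  moreover have "?\<Phi> (\<lambda>i\<in>{..t}. v i \<omega>) = (X t \<omega>, v 0 \<omega>)" for \<omega>
    unfolding X_def by (auto intro!: trajectory_cong)
  ultimately show ?thesis
    using indep_vars_Suc_noise[OF indep noise, of ?\<Phi> t _ F] assms by simp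
qed

text \<open>Induction with the filter step. The mean depends on the law and is only asserted to
  exist; the precision is explicit because its recursion adds the square of \<open>f (x t)\<close>
  and involves neither the input nor the new output.\<close>

lemma trajectory_posterior:
  "\<exists>m \<in> borel_measurable (\<Pi>\<^sub>M i\<in>{..t}. borel).
     gaussian_posterior M (\<Pi>\<^sub>M i\<in>{..t}. borel) (X t) (v 0) m (information P f t)"
proof (induction t)
  case 0
  have "gaussian_posterior M (\<Pi>\<^sub>M i\<in>{..0}. borel) (X 0) (v 0) (\<lambda>_. \<theta>0) (information P f 0)"
    unfolding gaussian_posterior_def
  proof
    fix F :: "(nat \<Rightarrow> real) \<times> real \<Rightarrow> ennreal" assume F: "F \<in> borel_measurable ((\<Pi>\<^sub>M i\<in>{..0::nat}. borel) \<Otimes>\<^sub>M borel)"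
    \<comment> \<open>The initial history is the constant \<open>c\<close>, so the conditional law
      is the prior, whose deviation \<open>sqrt P\<close> equals
      \<open>1 / sqrt (1 / P)\<close>.\<close>
    let ?x = "\<lambda>i\<in>{..0::nat}. c"
    have Fx: "(\<lambda>x. F (?x, x)) \<in> borel_measurable borel"
      by (rule measurable_Pair2[OF F]) (simp add: space_PiM)
    have "(\<integral>\<^sup>+\<omega>. F (?x, v 0 \<omega>) \<partial>M) = (\<integral>\<^sup>+x. ennreal (normal_density \<theta>0 (sqrt P) x) * F (?x, x) \<partial>lborel)"
      by (rule distributed_nn_integral[OF parameter, symmetric]) (simp only: measurable_lborel2 Fx)
    then show "(\<integral>\<^sup>+\<omega>. F (X 0 \<omega>, v 0 \<omega>) \<partial>M) = (\<integral>\<^sup>+\<omega>. (\<integral>\<^sup>+x. F (X 0 \<omega>, x) *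
        ennreal (normal_density \<theta>0 (1 / sqrt (information P f 0 (X 0 \<omega>))) x) \<partial>lborel) \<partial>M)"
      by (simp add: X_def information_def real_sqrt_divide emeasure_space_1 mult.commute)
  qed
  then show ?case by (intro bexI[of _ "\<lambda>_. \<theta>0"]) auto
next
  case (Suc t)
  let ?N = "\<Pi>\<^sub>M i\<in>{..t}. (borel :: real measure)" and ?N' = "\<Pi>\<^sub>M i\<in>{..Suc t}. (borel :: real measure)"
  from Suc obtain m where m[measurable]: "m \<in> borel_measurable ?N"
    and post: "gaussian_posterior M ?N (X t) (v 0) m (information P f t)" by blast
  have r[measurable]: "information P f t \<in> borel_measurable ?N"
    by (rule measurable_information) auto
  let ?Y = "\<lambda>\<omega>. v 0 \<omega> * f (X t \<omega> t) + h t (X t \<omega>) + v (Suc t) \<omega>"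
  let ?r = "information P f t"
  let ?m' = "\<lambda>(x, y). (?r x * m x + f (x t) * (y - h t x)) / (?r x + (f (x t))\<^sup>2)"
  let ?r' = "\<lambda>(x, y::real). ?r x + (f (x t))\<^sup>2"
  \<comment> \<open>Inverse of appending the new output, used to restate the updated filter on
    histories up to \<open>Suc t\<close>.\<close>
  let ?p = "\<lambda>z. (restrict z {..t}, z (Suc t))"
  have "gaussian_posterior M (?N \<Otimes>\<^sub>M borel) (\<lambda>\<omega>. (X t \<omega>, ?Y \<omega>)) (v 0) ?m' ?r'"
    by (rule gaussian_posterior_update[OF X_measurable v_measurable v_measurable _ h_measurable r m _ post noise_step])
       (simp_all add: information_pos P)
  then have upd: "gaussian_posterior M ?N' (\<lambda>\<omega>. (\<lambda>z. (fst z)(Suc t := snd z)) (X t \<omega>, ?Y \<omega>)) (v 0)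
      (\<lambda>z. ?m' (?p z)) (\<lambda>z. ?r' (?p z))"
  proof (rule gaussian_posterior_transport)
    show "(\<lambda>\<omega>. (X t \<omega>, ?Y \<omega>)) \<in> M \<rightarrow>\<^sub>M ?N \<Otimes>\<^sub>M borel" by measurable
    show "(\<lambda>z. (fst z)(Suc t := snd z)) \<in> ?N \<Otimes>\<^sub>M borel \<rightarrow>\<^sub>M ?N'" by (rule measurable_history_extend)
    show "?p ((fst z)(Suc t := snd z)) = z" if "z \<in> space (?N \<Otimes>\<^sub>M borel)" for z
      using that by (auto simp: space_pair_measure space_PiM PiE_def extensional_def fun_eq_iff)
  qed
  have X_eq: "(\<lambda>\<omega>. (\<lambda>z. (fst z)(Suc t := snd z)) (X t \<omega>, ?Y \<omega>)) = X (Suc t)"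
    by (simp only: X_Suc fst_conv snd_conv fun_eq_iff) simp
  have r_eq: "(\<lambda>z. ?r' (?p z)) = information P f (Suc t)"
    by (simp add: fun_eq_iff information_def)
  have "(\<lambda>z. ?m' (?p z)) \<in> borel_measurable ?N'"
  proof (rule measurable_compose[of ?p])
    show "?p \<in> ?N' \<rightarrow>\<^sub>M ?N \<Otimes>\<^sub>M borel"
      by (intro measurable_Pair measurable_restrict_subset measurable_component_singleton) auto
    show "?m' \<in> borel_measurable (?N \<Otimes>\<^sub>M borel)" by measurable
  qed
  with upd[unfolded X_eq r_eq] show ?case by (rule bexI)
qed

text \<open>Given the past, the control acts on the next output only through the mean \<mu>. It is
  left unspecified since the later estimates are uniform in the mean.\<close>

lemma trajectory_predictive:
  obtains \<mu> where "\<And>F :: (nat \<Rightarrow> real) \<times> real \<Rightarrow> ennreal. F \<in> borel_measurable ((\<Pi>\<^sub>M i\<in>{..t}. borel) \<Otimes>\<^sub>M borel) \<Longrightarrow>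
    (\<integral>\<^sup>+\<omega>. F (X t \<omega>, X (Suc t) \<omega> (Suc t)) \<partial>M) =
    (\<integral>\<^sup>+\<omega>. (\<integral>\<^sup>+y. F (X t \<omega>, y) *
      ennreal (normal_density (\<mu> (X t \<omega>)) (innovation_sd P f t (X t \<omega>)) y) \<partial>lborel) \<partial>M)"
proof -
  obtain m where m: "m \<in> borel_measurable (\<Pi>\<^sub>M i\<in>{..t}. borel)"
    and post: "gaussian_posterior M (\<Pi>\<^sub>M i\<in>{..t}. borel) (X t) (v 0) m (information P f t)"
    using trajectory_posterior by blast
  have r: "information P f t \<in> borel_measurable (\<Pi>\<^sub>M i\<in>{..t}. borel)"
    by (rule measurable_information) auto
  show thesis
  proof (rule that)
    fix F :: "(nat \<Rightarrow> real) \<times> real \<Rightarrow> ennreal" assume F: "F \<in> borel_measurable ((\<Pi>\<^sub>M i\<in>{..t}. borel) \<Otimes>\<^sub>M (borel :: real measure))"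
    show "(\<integral>\<^sup>+\<omega>. F (X t \<omega>, X (Suc t) \<omega> (Suc t)) \<partial>M) =
      (\<integral>\<^sup>+\<omega>. (\<integral>\<^sup>+y. F (X t \<omega>, y) * ennreal (normal_density (m (X t \<omega>) * f (X t \<omega> t) + h t (X t \<omega>))
        (innovation_sd P f t (X t \<omega>)) y) \<partial>lborel) \<partial>M)"
      unfolding X_Suc fun_upd_same information_Suc
      by (rule gaussian_predictive[OF X_measurable v_measurable v_measurable _ h_measurable r m _ post noise_step F])
         (simp_all add: information_pos P)
  qed
qed

text \<open>The event is a first failure at step \<open>t\<close>. Given a past without failure, the
  next output is normal with deviation at least \<open>s\<close>, so it falls in \<open>S4\<close>
  with probability at most \<open>8 * b\<close> and below the threshold with probability at most
  \<open>1 / (t + N)^2\<close>.\<close>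

lemma prob_not_escaping:
  assumes b: "0 \<le> b"
    and density: "\<And>l x. s \<le> l \<Longrightarrow> emeasure lborel (S4 f L \<inter> {x - l..x + l}) \<le> ennreal (b * l)"
    and sd: "\<And>\<omega>. \<omega> \<in> space M \<Longrightarrow> (\<And>i. i < t \<Longrightarrow> escaping P f L N i (X t \<omega>)) \<Longrightarrow> s \<le> innovation_sd P f t (X t \<omega>)"
  shows "{\<omega> \<in> space M. (\<forall>i<t. escaping P f L N i (X t \<omega>)) \<and> \<not> escaping P f L N t (X (Suc t) \<omega>)} \<in> events"
      (is "?B \<in> events")
    and "prob {\<omega> \<in> space M. (\<forall>i<t. escaping P f L N i (X t \<omega>)) \<and> \<not> escaping P f L N t (X (Suc t) \<omega>)}
      \<le> 8 * b + 1 / (real (t + N))\<^sup>2"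
proof -
  let ?N = "\<Pi>\<^sub>M i\<in>{..t}. (borel :: real measure)"
  let ?e = "1 / (real (t + N))\<^sup>2"
  obtain \<mu> where \<mu>: "\<And>F :: (nat \<Rightarrow> real) \<times> real \<Rightarrow> ennreal. F \<in> borel_measurable (?N \<Otimes>\<^sub>M borel) \<Longrightarrow>
    (\<integral>\<^sup>+\<omega>. F (X t \<omega>, X (Suc t) \<omega> (Suc t)) \<partial>M) =
    (\<integral>\<^sup>+\<omega>. (\<integral>\<^sup>+y. F (X t \<omega>, y) *
      ennreal (normal_density (\<mu> (X t \<omega>)) (innovation_sd P f t (X t \<omega>)) y) \<partial>lborel) \<partial>M)"
    using trajectory_predictive by blast
  let ?good = "\<lambda>x. \<forall>i<t. escaping P f L N i x"
  \<comment> \<open>The first failure as a set of pairs of past and next output, ready to be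
    integrated against the predictive law.\<close>
  define A where "A = {z \<in> space (?N \<Otimes>\<^sub>M borel). ?good (fst z) \<and>
    (snd z \<in> S4 f L \<or> \<bar>snd z\<bar> < ?e * innovation_sd P f t (fst z))}"
  have information_meas: "information P f j \<in> borel_measurable ?N" if "j \<le> Suc t" for j
    using that by (intro measurable_information f) auto
  have [measurable]: "information P f t \<in> borel_measurable ?N" "information P f (Suc t) \<in> borel_measurable ?N"
    by (auto intro: information_meas)
  have [measurable]: "Measurable.pred ?N (\<lambda>x. escaping P f L N i x)" if "i < t" for i
  proof -
    have [measurable]: "information P f i \<in> borel_measurable ?N" "information P f (Suc i) \<in> borel_measurable ?N"
      "(\<lambda>x. x (Suc i)) \<in> borel_measurable ?N"
      using that by (auto intro: information_meas measurable_component_singleton)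
    have [measurable]: "Suc i \<in> {..t}" using that by simp
    show ?thesis unfolding escaping_def not_less[symmetric] by measurable
  qed
  have [measurable]: "Measurable.pred ?N ?good" by measurable
  have A[measurable]: "A \<in> sets (?N \<Otimes>\<^sub>M borel)" unfolding A_def by measurable
  \<comment> \<open>The information up to time \<open>Suc t\<close> reads only outputs up to
    \<open>t\<close>, so the threshold at step \<open>t\<close> is already fixed by the
    past.\<close>
  have info_eq: "information P f j (X (Suc t) \<omega>) = information P f j (X t \<omega>)" if "j \<le> Suc t" for j \<omega>
    using that by (auto simp: information_def X_Suc intro!: sum.cong)
  have B_eq: "?B = (\<lambda>\<omega>. (X t \<omega>, X (Suc t) \<omega> (Suc t))) -` A \<inter> space M"
    using measurable_space[OF X_measurable[of t]]
    by (auto simp: A_def escaping_def[of _ _ _ _ t] info_eq space_pair_measure not_le)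
  have [measurable]: "(\<lambda>\<omega>. X (Suc t) \<omega> (Suc t)) \<in> borel_measurable M"
    by (rule measurable_compose[OF X_measurable state_measurable])
  show B: "?B \<in> events" unfolding B_eq by (intro measurable_sets[OF _ A] measurable_Pair) measurable
  have "emeasure M ?B = (\<integral>\<^sup>+\<omega>. indicator ?B \<omega> \<partial>M)" by (rule nn_integral_indicator[OF B, symmetric])
  also have "\<dots> = (\<integral>\<^sup>+\<omega>. indicator A (X t \<omega>, X (Suc t) \<omega> (Suc t)) \<partial>M)"
    unfolding B_eq by (intro nn_integral_cong) (simp add: indicator_def)
  also have "\<dots> = (\<integral>\<^sup>+\<omega>. (\<integral>\<^sup>+y. indicator A (X t \<omega>, y) *
      ennreal (normal_density (\<mu> (X t \<omega>)) (innovation_sd P f t (X t \<omega>)) y) \<partial>lborel) \<partial>M)"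
    by (rule \<mu>) measurable
  also have "\<dots> \<le> (\<integral>\<^sup>+\<omega>. ennreal (8 * b + ?e) \<partial>M)"
  proof (rule nn_integral_mono)
    fix \<omega> assume \<omega>: "\<omega> \<in> space M"
    define \<sigma> where "\<sigma> = innovation_sd P f t (X t \<omega>)"
    define m where "m = \<mu> (X t \<omega>)"
    let ?S = "S4 f L" and ?T = "{y. \<bar>y\<bar> < ?e * \<sigma>}"
    let ?n = "\<lambda>y. ennreal (normal_density m \<sigma> y)"
    show "(\<integral>\<^sup>+y. indicator A (X t \<omega>, y) * ennreal (normal_density (\<mu> (X t \<omega>))
        (innovation_sd P f t (X t \<omega>)) y) \<partial>lborel) \<le> ennreal (8 * b + ?e)"
      unfolding \<sigma>_def[symmetric] m_def[symmetric]
    proof (cases "?good (X t \<omega>)")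
      case True
      have s0: "0 < \<sigma>" using information_pos[OF P] by (simp add: \<sigma>_def)
      have "(\<integral>\<^sup>+y. indicator A (X t \<omega>, y) * ?n y \<partial>lborel) \<le>
        (\<integral>\<^sup>+y. indicator ?S y * ?n y + indicator ?T y * ?n y \<partial>lborel)"
        by (intro nn_integral_mono) (auto simp: A_def \<sigma>_def indicator_def)
      also have "\<dots> = (\<integral>\<^sup>+y. indicator ?S y * ?n y \<partial>lborel) + (\<integral>\<^sup>+y. indicator ?T y * ?n y \<partial>lborel)"
        by (intro nn_integral_add) measurable
      also have "\<dots> \<le> ennreal (8 * b) + ennreal ?e"
      proof (intro add_mono normal_measure_le normal_measure_small_ball_le s0 b)
        show "emeasure lborel (?S \<inter> {m - l..m + l}) \<le> ennreal (b * l)" if "\<sigma> \<le> l" for l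
          using that sd[OF \<omega>] True unfolding \<sigma>_def by (intro density) auto
      qed auto
      finally show "(\<integral>\<^sup>+y. indicator A (X t \<omega>, y) * ?n y \<partial>lborel) \<le> ennreal (8 * b + ?e)"
        using b by (simp add: ennreal_plus[symmetric] del: ennreal_plus)
    qed (simp add: A_def)
  qed
  also have "\<dots> = ennreal (8 * b + ?e)" by (simp add: emeasure_space_1)
  finally show "prob ?B \<le> 8 * b + ?e"
    using b unfolding emeasure_eq_measure by (subst (asm) ennreal_le_iff) auto
qed

end

end

section \<open>Choice of the constants and summation of the first-failure probabilities\<close>

theorem theorem2p5:
  fixes M :: "'a measure" and f :: "real \<Rightarrow> real"
    and \<theta> :: "'a \<Rightarrow> real" and w :: "nat \<Rightarrow> 'a \<Rightarrow> real" and \<theta>0 P0 :: real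
  assumes "prob_space M"
    and "piecewise_continuous f"
    and "prob_space.indep_vars M (\<lambda>_. borel) w {1..}"
    and "\<And>t. t \<ge> 1 \<Longrightarrow> distr M borel (w t) = distr M borel (w 1)"
    and "distributed M lborel (w 1) (normal_density 0 1)"
    and "P0 > 0"
    and "distributed M lborel \<theta> (normal_density \<theta>0 (sqrt P0))"
    and "indep_rv M borel \<theta> (\<Pi>\<^sub>M t\<in>{1..}. borel) (\<lambda>\<omega>. \<lambda>t\<in>{1..}. w t \<omega>)"
    and "\<exists>\<delta>>0. \<exists>L>0.
           (\<lambda>l::real. SUP x. measure lebesgue (S4 f L \<inter> {x - l..x + l}) / l)
             \<in> O[at_top](\<lambda>l. 1 / (ln (ln l)) powr (1 + \<delta>))"
  shows "unstabilizable M f \<theta> w"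
  unfolding unstabilizable_def
proof (intro allI impI)
  fix h assume h: "feedback_law h"
  interpret prob_space M by fact
  have f: "f \<in> borel_measurable borel"
    using assms(2) by (rule piecewise_continuous_borel_measurable)
  obtain \<delta> L where \<delta>: "0 < \<delta>" and L: "0 < L" and O:
    "(\<lambda>l::real. SUP x. measure lebesgue (S4 f L \<inter> {x - l..x + l}) / l)
      \<in> O[at_top](\<lambda>l. 1 / (ln (ln l)) powr (1 + \<delta>))"
    using assms(9) by blast
  obtain C l0 where C: "0 < C" and density: "\<And>l x. l0 \<le> l \<Longrightarrow>
      emeasure lborel (S4 f L \<inter> {x - l..x + l}) \<le> ennreal (C / ln (ln l) powr (1 + \<delta>) * l)"
    using S4_density[OF f \<delta> O] by blast

  define v where "v = (\<lambda>i. if i = 0 then \<theta> else w i)"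
  have indep: "indep_vars (\<lambda>_. borel) v UNIV"
    unfolding v_def using assms(3,8) by (rule indep_vars_Cons)
  have parameter: "distributed M lborel (v 0) (normal_density \<theta>0 (sqrt P0))"
    using assms(7) by (simp add: v_def)
  have noise: "distributed M lborel (v (Suc t)) (normal_density 0 1)" for t
  proof -
    have "v (Suc t) \<in> M \<rightarrow>\<^sub>M borel"
      using indep unfolding indep_vars_def by blast
    then have "v (Suc t) \<in> M \<rightarrow>\<^sub>M lborel"
      by (subst measurable_cong_sets[OF refl sets_lborel])
    moreover have "distr M lborel (w i) = distr M borel (w i)" for i
      by (rule distr_cong) simp_all
    then have "distr M lborel (v (Suc t)) = distr M lborel (w 1)"
      using assms(4)[of "Suc t"] unfolding v_def by (metis le_add1 plus_1_eq_Suc nat.distinct(1))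
    ultimately show ?thesis by (rule distributed_cong_distr[OF assms(5)])
  qed

  \<comment> \<open>\<open>b n\<close> bounds the density of \<open>S4\<close> at scales with
    \<open>ln (ln l) \<ge> n * ln 2\<close>, in particular for \<open>l \<ge> exp (2 ^ n)\<close>.
    \<open>q n\<close> is the resulting bound for a first failure at the step with
    \<open>n = t + N\<close>; \<delta> > 0 makes it summable.\<close>
  define b where "b n = C / (real n * ln 2) powr (1 + \<delta>)" for n
  define q where "q n = 8 * b n + 1 / (real n)\<^sup>2" for n
  have "summable (\<lambda>n. 8 * (C / ln 2 powr (1 + \<delta>)) * (real n powr (- (1 + \<delta>))) + 1 / (real n)\<^sup>2)"
    using \<delta> inverse_power_summable[of 2, where 'a = real]
    by (intro summable_add summable_mult) (auto simp: summable_real_powr_iff inverse_eq_divide)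
  also have "(\<lambda>n. 8 * (C / ln 2 powr (1 + \<delta>)) * (real n powr (- (1 + \<delta>))) + 1 / (real n)\<^sup>2) = q"
    unfolding q_def b_def fun_eq_iff powr_minus by (simp add: powr_mult field_simps)
  finally have q_summable: "summable q" .
  obtain N0 where N0: "\<And>n. N0 \<le> n \<Longrightarrow> norm (\<Sum>i. q (i + n)) < 1"
    using suminf_exist_split[OF _ q_summable, of 1] by auto
  obtain N1 where N1: "l0 \<le> real N1" using real_arch_simple by blast
  \<comment> \<open>\<open>N0\<close> makes the tail sum of \<open>q\<close> less than 1,
    \<open>N1\<close> puts the scales \<open>exp (2 ^ (t + N))\<close> beyond \<open>l0\<close>, and
    1 keeps the divisors \<open>t + N\<close> positive.\<close>
  define N where "N = max 1 (max N0 N1)"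
  have N: "1 \<le> N" "l0 \<le> real N" "N0 \<le> N" using N1 by (auto simp: N_def)
  have q_less: "(\<Sum>i. q (i + N)) < 1" using N0[OF N(3)] by simp
  have b_nonneg: "0 \<le> b n" for n using C by (simp add: b_def)
  have density_N: "emeasure lborel (S4 f L \<inter> {x - l..x + l}) \<le> ennreal (b (t + N) * l)"
    if l: "exp (2 ^ (t + N)) \<le> l" for l x t
  proof -
    let ?n = "t + N"
    have "real N \<le> real ?n" by simp
    also have "\<dots> \<le> 2 ^ ?n" by (rule less_imp_le[OF of_nat_less_two_power])
    also have "\<dots> \<le> exp (2 ^ ?n)" using exp_ge_add_one_self[of "2 ^ ?n :: real"] by linarith
    finally have "l0 \<le> l" using N l by linarith
    have l_pos: "0 < l" using l by (rule less_le_trans[OF exp_gt_zero])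
    then have "2 ^ ?n \<le> ln l" using l by (simp add: ln_ge_iff)
    then have "ln (2 ^ ?n) \<le> ln (ln l)" by (intro ln_mono) auto
    then have "real ?n * ln 2 \<le> ln (ln l)" by (simp add: ln_realpow)
    moreover have "0 < real ?n * ln 2" using N by simp
    ultimately have "C / ln (ln l) powr (1 + \<delta>) \<le> b ?n"
      unfolding b_def using C \<delta> by (intro divide_left_mono powr_mono2 mult_pos_pos) auto
    then show ?thesis
      using density[OF \<open>l0 \<le> l\<close>, of x] l_pos
      by (meson ennreal_leI mult_right_mono less_imp_le order_trans)
  qed

  \<comment> \<open>\<open>T\<close> is the threshold in \<open>escaping_innovation_sd\<close>. The
    initial value \<open>c\<close> meets it: as \<open>c \<ge> 1\<close> lies outside
    \<open>S4\<close>, the square of \<open>f c\<close> is at least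
    \<open>L^2 * c^8 \<ge> L^2 * c \<ge> exp T\<close>.\<close>
  define T where "T = 2 * 2 ^ N + \<bar>ln P0\<bar> + 16 * real N + 2 * \<bar>ln L\<bar> - 2 * ln P0"
  obtain c where c: "max 1 (exp T / L\<^sup>2) \<le> c" "c \<notin> S4 f L"
    using exists_large_outside_S4[OF f \<delta> density] by blast
  have init: "T \<le> ln (1 / P0 + (f c)\<^sup>2)"
  proof -
    have "exp T \<le> L\<^sup>2 * c" using c L by (simp add: field_simps)
    also have "\<dots> \<le> L\<^sup>2 * c ^ 8" using c by (intro mult_left_mono self_le_power) auto
    also have "\<dots> = (L * \<bar>c\<bar> ^ 4)\<^sup>2" by (simp add: power_mult_distrib flip: power_mult)
    also have "\<dots> \<le> \<bar>f c\<bar>\<^sup>2" using c L by (intro power_mono) (auto simp: S4_def)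
    also have "\<dots> \<le> 1 / P0 + (f c)\<^sup>2" using assms(6) by simp
    finally show ?thesis using assms(6) by (subst ln_ge_iff) (auto intro: add_pos_nonneg)
  qed

  define X where "X t \<omega> = trajectory f h c (\<lambda>i. v i \<omega>) t" for t \<omega>
  define y where "y t \<omega> = X t \<omega> t" for t \<omega>
  have X_le: "X t \<omega> i = y i \<omega>" if "i \<le> t" for i t \<omega>
    unfolding X_def y_def using that by (rule trajectory_le)
  have sd: "exp (2 ^ (t + N)) \<le> innovation_sd P0 f t x"
    if "\<And>i. i < t \<Longrightarrow> escaping P0 f L N i x" "x 0 = c" for t x
    by (rule escaping_innovation_sd[OF assms(6) L N(1)]) (use init that in \<open>auto simp: T_def\<close>)
  \<comment> \<open>First failure at step \<open>t\<close>: success at all earlier steps supplies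
    the large deviation that makes a failure unlikely.\<close>
  define B where "B t = {\<omega> \<in> space M. (\<forall>i<t. escaping P0 f L N i (X t \<omega>)) \<and>
    \<not> escaping P0 f L N t (X (Suc t) \<omega>)}" for t
  have B: "B t \<in> events" "prob (B t) \<le> q (t + N)" for t
  proof -
    have *: "exp (2 ^ (t + N)) \<le> innovation_sd P0 f t (trajectory f h c (\<lambda>i. v i \<omega>) t)"
      if "\<And>i. i < t \<Longrightarrow> escaping P0 f L N i (trajectory f h c (\<lambda>i. v i \<omega>) t)" for \<omega>
      using that by (intro sd trajectory_0) auto
    show "B t \<in> events" "prob (B t) \<le> q (t + N)"
      using prob_not_escaping[OF f h assms(6) indep parameter noise b_nonneg density_N *]
      unfolding B_def X_def q_def by blast+
  qed
  have q_shift: "summable (\<lambda>t. q (t + N))"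
    using q_summable by (rule summable_ignore_initial_segment)
  have B_summable: "summable (\<lambda>t. prob (B t))"
    by (rule summable_comparison_test'[OF q_shift, of 0]) (simp add: B(2))
  have "prob (\<Union>t. B t) \<le> (\<Sum>t. prob (B t))"
    using B(1) B_summable by (intro finite_measure_subadditive_countably) auto
  also have "\<dots> \<le> (\<Sum>t. q (t + N))"
    by (rule suminf_le[OF B(2) B_summable q_shift])
  also have "\<dots> < 1" by (rule q_less)
  finally have less_1: "prob (\<Union>t. B t) < 1" .
  define D where "D = space M - (\<Union>t. B t)"
  have D: "D \<in> events" "0 < prob D"
    using less_1 B(1) unfolding D_def by (auto simp: prob_compl)
  \<comment> \<open>A path outside every \<open>B t\<close> has no first failure, hence no failure
    at all.\<close>
  have escaping_D: "escaping P0 f L N t (\<lambda>i. y i \<omega>)" if "\<omega> \<in> D" for \<omega> t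
  proof (induction t rule: less_induct)
    case (less t)
    have "escaping P0 f L N i (X t \<omega>)" if "i < t" for i
      using less[OF that] escaping_cong[of i "X t \<omega>" "\<lambda>i. y i \<omega>"] X_le that by auto
    moreover have "\<omega> \<notin> B t" "\<omega> \<in> space M" using \<open>\<omega> \<in> D\<close> by (auto simp: D_def)
    ultimately have "escaping P0 f L N t (X (Suc t) \<omega>)" by (auto simp: B_def)
    then show ?case using escaping_cong[of t "X (Suc t) \<omega>" "\<lambda>i. y i \<omega>"] X_le by auto
  qed
  have unbounded: "limsup (\<lambda>t. ereal (1 / real t * (\<Sum>i = 1..t. (y i \<omega>)\<^sup>2))) = \<infinity>" if "\<omega> \<in> D" for \<omega>
  proof (rule average_unbounded[OF N(1)])
    fix t
    have "exp (2 ^ (t + N)) / (real (t + N))\<^sup>2 \<le> 1 / (real (t + N))\<^sup>2 * innovation_sd P0 f t (\<lambda>i. y i \<omega>)"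
      using sd[of t "\<lambda>i. y i \<omega>"] escaping_D[OF that]
      by (simp add: divide_right_mono y_def X_def trajectory_0)
    also have "\<dots> \<le> \<bar>y (Suc t) \<omega>\<bar>" using escaping_D[OF that, of t] by (simp add: escaping_def)
    finally show "exp (2 ^ (t + N)) / (real (t + N))\<^sup>2 \<le> \<bar>y (Suc t) \<omega>\<bar>" .
  qed
  have "closed_loop f \<theta> w h y"
    unfolding closed_loop_def
  proof (intro allI)
    fix t \<omega>
    have "history y t \<omega> = X t \<omega>"
      using history_trajectory[of f h c "\<lambda>\<omega> i. v i \<omega>" t \<omega>] by (simp add: X_def y_def[abs_def])
    then show "y (Suc t) \<omega> = \<theta> \<omega> * f (y t \<omega>) + h t (history y t \<omega>) + w (Suc t) \<omega>"
      by (simp add: y_def X_def v_def)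
  qed
  moreover have "indep_rv M borel (y 0) (borel \<Otimes>\<^sub>M (\<Pi>\<^sub>M t\<in>{1..}. borel)) (\<lambda>\<omega>. (\<theta> \<omega>, \<lambda>t\<in>{1..}. w t \<omega>))"
  proof -
    have "y 0 = (\<lambda>_. c)" by (simp add: fun_eq_iff y_def X_def)
    moreover have "(\<lambda>\<omega>. (\<theta> \<omega>, \<lambda>t\<in>{1..}. w t \<omega>)) \<in> M \<rightarrow>\<^sub>M borel \<Otimes>\<^sub>M (\<Pi>\<^sub>M t\<in>{1..}. borel)"
      using assms(8) unfolding indep_rv_def by (intro measurable_Pair) blast+
    ultimately show ?thesis by (simp only: indep_rv_const space_borel UNIV_I)
  qed
  ultimately show "\<exists>y. closed_loop f \<theta> w h y \<and>
      indep_rv M borel (y 0) (borel \<Otimes>\<^sub>M (\<Pi>\<^sub>M t\<in>{1..}. borel)) (\<lambda>\<omega>. (\<theta> \<omega>, \<lambda>t\<in>{1..}. w t \<omega>)) \<and>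
      (\<exists>D \<in> events. 0 < prob D \<and>
        (\<forall>\<omega>\<in>D. limsup (\<lambda>t. ereal (1 / real t * (\<Sum>i = 1..t. (y i \<omega>)\<^sup>2))) = \<infinity>))"
    using D unbounded by blast
qed

end
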